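(* Given a chordal graph $G=(V,E)$, one can compute in polynomial time a rooted clique-tree $\mathcal{T}_G$ of $G$ such that for every non-root maximal clique $K_i$, with $S_i=K_i\cap K_{p(i)}$, and for every child $K_j$ of $K_{p(i)}$ in $\mathcal{T}_G$ (possibly $j=i$), there is no minimal separator of the graph $G_j$ that is contained in $S_i$.
   Context: A clique-tree of a chordal graph $G$ is a tree whose nodes are the maximal cliques of $G$ such that for every vertex $v$, the maximal cliques containing $v$ induce a subtree. A rooted clique-tree is a clique-tree with a distinguished root maximal clique $K_0$; for a non-root node $K_i$, $K_{p(i)}$ denotes its father. For a node $K_i$, $\mathcal{T}_G^i$ is the subtree rooted at $K_i$, and $G_i$ is the subgraph of $G$ induced by the union of the maximal cliques in $\mathcal{T}_G^i$. A minimal separator of a graph $H$ is a set $S$ that is an inclusion-minimal $uv$-separator (a set whose removal disconnects $u$ and $v$) for some vertices $u,v$. *)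

theory Defs
  imports "HOL-Computational_Algebra.Polynomial"
begin

subsection \<open>Graphs\<close>

datatype 'a ugraph = UGraph (verts: "'a set") (edges: "'a set set")

definition simple_graph :: "'a ugraph \<Rightarrow> bool" where
  "simple_graph G \<longleftrightarrow> finite (verts G) \<and>
     (\<forall>e\<in>edges G. \<exists>u v. u \<in> verts G \<and> v \<in> verts G \<and> u \<noteq> v \<and> e = {u, v})"

definition adj :: "'a ugraph \<Rightarrow> 'a \<Rightarrow> 'a \<Rightarrow> bool" where
  "adj G u v \<longleftrightarrow> {u, v} \<in> edges G"

definition induced :: "'a ugraph \<Rightarrow> 'a set \<Rightarrow> 'a ugraph" where
  "induced G W = UGraph (verts G \<inter> W) {e \<in> edges G. e \<subseteq> W}"

definition path_betw :: "'a ugraph \<Rightarrow> 'a \<Rightarrow> 'a list \<Rightarrow> 'a \<Rightarrow> bool" where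
  "path_betw G u xs v \<longleftrightarrow> xs \<noteq> [] \<and> hd xs = u \<and> last xs = v \<and>
     distinct xs \<and> set xs \<subseteq> verts G \<and> successively (adj G) xs"

definition connected_graph :: "'a ugraph \<Rightarrow> bool" where
  "connected_graph G \<longleftrightarrow> verts G \<noteq> {} \<and>
     (\<forall>u\<in>verts G. \<forall>v\<in>verts G. \<exists>xs. path_betw G u xs v)"

definition is_cycle :: "'a ugraph \<Rightarrow> 'a list \<Rightarrow> bool" where
  "is_cycle G xs \<longleftrightarrow> length xs \<ge> 3 \<and> distinct xs \<and> set xs \<subseteq> verts G \<and>
     successively (adj G) xs \<and> adj G (last xs) (hd xs)"

definition has_chord :: "'a ugraph \<Rightarrow> 'a list \<Rightarrow> bool" where
  "has_chord G xs \<longleftrightarrow> (\<exists>i j. i < j \<and> j < length xs \<and> j \<noteq> Suc i \<and>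
     \<not> (i = 0 \<and> Suc j = length xs) \<and> adj G (xs ! i) (xs ! j))"

definition chordal :: "'a ugraph \<Rightarrow> bool" where
  "chordal G \<longleftrightarrow> (\<forall>xs. is_cycle G xs \<and> length xs \<ge> 4 \<longrightarrow> has_chord G xs)"

definition is_tree :: "'a ugraph \<Rightarrow> bool" where
  "is_tree T \<longleftrightarrow> simple_graph T \<and> connected_graph T \<and> (\<nexists>xs. is_cycle T xs)"

definition clique :: "'a ugraph \<Rightarrow> 'a set \<Rightarrow> bool" where
  "clique G K \<longleftrightarrow> K \<subseteq> verts G \<and> (\<forall>u\<in>K. \<forall>v\<in>K. u \<noteq> v \<longrightarrow> adj G u v)"

definition maximal_clique :: "'a ugraph \<Rightarrow> 'a set \<Rightarrow> bool" where
  "maximal_clique G K \<longleftrightarrow> clique G K \<and> (\<forall>K'. clique G K' \<and> K \<subseteq> K' \<longrightarrow> K' = K)"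

definition uv_separator :: "'a ugraph \<Rightarrow> 'a \<Rightarrow> 'a \<Rightarrow> 'a set \<Rightarrow> bool" where
  "uv_separator H u v S \<longleftrightarrow> u \<in> verts H - S \<and> v \<in> verts H - S \<and> S \<subseteq> verts H \<and>
     (\<nexists>xs. path_betw (induced H (verts H - S)) u xs v)"

text \<open>If \<open>u\<close> and \<open>v\<close> lie in different components of \<open>H\<close>, then the empty set is a minimal
  \<open>uv\<close>-separator; so a disconnected graph has the empty set among its minimal separators.\<close>

definition minimal_separator :: "'a ugraph \<Rightarrow> 'a set \<Rightarrow> bool" where
  "minimal_separator H S \<longleftrightarrow>
     (\<exists>u v. uv_separator H u v S \<and> (\<forall>S'. S' \<subset> S \<longrightarrow> \<not> uv_separator H u v S'))"

subsection \<open>Rooted clique trees\<close>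

definition clique_tree :: "'a ugraph \<Rightarrow> 'a set ugraph \<Rightarrow> bool" where
  "clique_tree G T \<longleftrightarrow> is_tree T \<and> verts T = {K. maximal_clique G K} \<and>
     (\<forall>v\<in>verts G. is_tree (induced T {K. v \<in> K}))"

definition rooted_clique_tree :: "'a ugraph \<Rightarrow> 'a set ugraph \<Rightarrow> 'a set \<Rightarrow> bool" where
  "rooted_clique_tree G T R \<longleftrightarrow> clique_tree G T \<and> R \<in> verts T"

text \<open>A node belongs to the subtree rooted at \<open>K\<close> iff the (in a tree, unique) path from the
  root \<open>R\<close> to it passes through \<open>K\<close>.\<close>

definition subtree_nodes :: "'b ugraph \<Rightarrow> 'b \<Rightarrow> 'b \<Rightarrow> 'b set" where
  "subtree_nodes T R K = {L \<in> verts T. \<exists>xs. path_betw T R xs L \<and> K \<in> set xs}"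

definition father :: "'b ugraph \<Rightarrow> 'b \<Rightarrow> 'b \<Rightarrow> 'b \<Rightarrow> bool" where
  "father T R P K \<longleftrightarrow> adj T P K \<and> K \<in> subtree_nodes T R P"

definition subtree_graph :: "'a ugraph \<Rightarrow> 'a set ugraph \<Rightarrow> 'a set \<Rightarrow> 'a set \<Rightarrow> 'a ugraph" where
  "subtree_graph G T R K = induced G (\<Union> (subtree_nodes T R K))"

subsection \<open>Model of computation\<close>

text \<open>
  While programs over a random access memory. A memory cell is addressed by an array name and a
  list of indices (the empty list for a scalar variable) and holds a natural number. The only
  arithmetic is addition and truncated subtraction; since there is no multiplication, numbers
  have only linearly many bits in the running time (plus the input length), and so unit-cost
  polynomial time coincides with polynomial time on Turing machines. The expressions occurring
  in a program are fixed, hence evaluating one takes a constant number of operations and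
  is charged to the command that contains it.
\<close>

type_synonym mem = "string \<times> nat list \<Rightarrow> nat"

datatype exp =
    Num nat
  | Get string "exp list"
  | Add exp exp
  | Sub exp exp

fun eval :: "mem \<Rightarrow> exp \<Rightarrow> nat" where
  "eval s (Num k) = k"
| "eval s (Get x is) = s (x, map (eval s) is)"
| "eval s (Add a b) = eval s a + eval s b"
| "eval s (Sub a b) = eval s a - eval s b"

datatype com =
    Skip
  | Assign string "exp list" exp
  | Seq com com
  | If exp com com
  | While exp com

text \<open>\<open>exec c s t s'\<close>: started in memory \<open>s\<close>, the program \<open>c\<close> halts after \<open>t\<close> steps in memory
  \<open>s'\<close>. A condition holds iff its value is nonzero.\<close>

inductive exec :: "com \<Rightarrow> mem \<Rightarrow> nat \<Rightarrow> mem \<Rightarrow> bool" where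
  Skip: "exec Skip s 1 s"
| Assign: "exec (Assign x is e) s 1 (s((x, map (eval s) is) := eval s e))"
| Seq: "exec c1 s t1 s' \<Longrightarrow> exec c2 s' t2 s'' \<Longrightarrow> exec (Seq c1 c2) s (t1 + t2) s''"
| IfTrue: "eval s b \<noteq> 0 \<Longrightarrow> exec c1 s t s' \<Longrightarrow> exec (If b c1 c2) s (1 + t) s'"
| IfFalse: "eval s b = 0 \<Longrightarrow> exec c2 s t s' \<Longrightarrow> exec (If b c1 c2) s (1 + t) s'"
| WhileFalse: "eval s b = 0 \<Longrightarrow> exec (While b c) s 1 s"
| WhileTrue: "eval s b \<noteq> 0 \<Longrightarrow> exec c s t1 s' \<Longrightarrow> exec (While b c) s' t2 s'' \<Longrightarrow>
    exec (While b c) s (1 + t1 + t2) s''"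

subsection \<open>Input and output encoding\<close>

text \<open>\<open>G\<close> is given by its adjacency matrix with respect to the vertex enumeration \<open>vs\<close>; all
  cells other than \<open>n\<close> and \<open>adj\<close> are initially 0.\<close>

definition graph_input :: "'a ugraph \<Rightarrow> 'a list \<Rightarrow> mem" where
  "graph_input G vs = (\<lambda>(x, is).
     if x = ''n'' \<and> is = [] then length vs
     else if x = ''adj'' \<and>
       (\<exists>i j. is = [i, j] \<and> i < length vs \<and> j < length vs \<and> adj G (vs ! i) (vs ! j)) then 1
     else 0)"

text \<open>The set of vertices whose indices are marked in row \<open>a\<close> of the array \<open>bag\<close>.\<close>

definition bag_of :: "'a list \<Rightarrow> mem \<Rightarrow> nat \<Rightarrow> 'a set" where
  "bag_of vs s a = {vs ! i | i. i < length vs \<and> s (''bag'', [a, i]) \<noteq> 0}"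

text \<open>The nodes of the rooted tree are numbered from 0 to \<open>m - 1\<close>. The edges need not be
  listed: every edge of a rooted tree joins a node with its father.\<close>

definition tree_output :: "'a list \<Rightarrow> mem \<Rightarrow> 'a set ugraph \<Rightarrow> 'a set \<Rightarrow> bool" where
  "tree_output vs s T R \<longleftrightarrow>
     bij_betw (bag_of vs s) {..<s (''m'', [])} (verts T) \<and>
     s (''root'', []) < s (''m'', []) \<and> bag_of vs s (s (''root'', [])) = R \<and>
     (\<forall>a < s (''m'', []). a \<noteq> s (''root'', []) \<longrightarrow>
        s (''parent'', [a]) < s (''m'', []) \<and>
        father T R (bag_of vs s (s (''parent'', [a]))) (bag_of vs s a))"

end

theory Submission
  imports Defs
begin

text \<open>
  Removing simplicial vertices one by one and inserting them again in reverse order builds the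
  maximal cliques as a sequence of bags: the neighbourhood \<open>N\<close> of a new vertex \<open>v\<close> among the
  vertices present is a clique, and either \<open>N\<close> is itself a bag, which is extended by \<open>v\<close>, or
  \<open>N \<union> {v}\<close> becomes a new bag. The new bag is attached to the \<^emph>\<open>first\<close> bag that contains
  \<open>N\<close>. Hence, if \<open>B\<close> is a child of \<open>A\<close> and \<open>P\<close> is a proper ancestor of \<open>A\<close>, then
  \<open>A \<inter> B\<close> is not contained in \<open>P\<close>. For a child \<open>J\<close> of \<open>P\<close>, adjacent bags in the subtree
  of \<open>J\<close> therefore always share a vertex outside \<open>P\<close>, so no subset of \<open>P\<close>
  separates \<open>G\<^sub>J\<close>.
\<close>

subsection \<open>Simplicial vertices of chordal graphs\<close>

text \<open>To survive further insertions, the separator property is phrased by indices instead of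
  ancestry: \<open>par_least\<close> speaks of every bag with index below \<open>par a\<close>.
  Fathers have smaller indices than their children, so this covers all proper ancestors of the
  father, and attaching a bag requires no inspection of the tree. The invariant persists because a
  new vertex enters exactly one bag, so the intersections of older bags never change. The sequence
  starts with one empty bag, the only maximal clique of the empty graph. Bag 0 is thus the root
  throughout, and the first vertex is treated like any other. Disconnected graphs fit the same
  scheme: a vertex without present neighbours has \<open>N = {}\<close>, for which bag 0 is the
  first candidate, so every father other than the root shares a vertex with each of its children.
  For the time bound, the algorithm is written with loops of exactly \<open>n\<close> passes. A
  polynomial can then be read off the syntax, and correctness concerns a total function on
  memories.\<close>

lemma adj_sym: "adj G u v \<Longrightarrow> adj G v u"
  by (simp add: adj_def insert_commute)

lemma adj_simple:
  assumes "simple_graph G" "adj G u v"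
  shows "u \<noteq> v" "u \<in> verts G" "v \<in> verts G"
  using assms unfolding simple_graph_def adj_def by (auto simp: doubleton_eq_iff)

text \<open>A shortest walk from \<open>y\<close> to \<open>y'\<close> through \<open>D\<close>,
  closed up by \<open>x\<close>, would be a chordless cycle of length at least 4.\<close>

lemma chordal_no_detour:
  assumes G: "simple_graph G" "chordal G"
    and y: "adj G x y" and y': "adj G x y'" and ne: "y \<noteq> y'" and nadj: "\<not> adj G y y'"
    and D: "D \<subseteq> verts G" "\<And>c. c \<in> D \<Longrightarrow> c \<noteq> x \<and> \<not> adj G x c"
    and xs: "xs \<noteq> []" "set xs \<subseteq> D" "successively (adj G) xs"
      "adj G y (hd xs)" "adj G (last xs) y'"
  shows False
proof -
  define walk where "walk p \<longleftrightarrow> p \<noteq> [] \<and> hd p = y \<and> last p = y' \<and> set p \<subseteq> D \<union> {y, y'} \<and>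
    successively (adj G) p" for p
  have "walk (y # xs @ [y'])"
    using xs unfolding walk_def by (auto simp: successively_append_iff successively_Cons)
  then obtain p where p: "walk p" and least: "\<And>q. walk q \<Longrightarrow> length p \<le> length q"
    using ex_has_least_nat[of walk _ length] by blast
  have p_ne: "p \<noteq> []" and hd: "hd p = y" and lst: "last p = y'"
    and sub: "set p \<subseteq> D \<union> {y, y'}" and succ: "successively (adj G) p"
    using p by (auto simp: walk_def)
  \<comment> \<open>An edge from \<open>p ! (i - 1)\<close> to \<open>p ! j\<close> shortcuts the
    walk. This excludes repeated vertices as well as chords between vertices of
    \<open>p\<close>.\<close>
  have cut: False if "0 < i" "i < j" "j < length p" "adj G (p ! (i - 1)) (p ! j)" for i j
  proof -
    let ?q = "take i p @ drop j p"
    have "last (take i p) = p ! (i - 1)"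
      using that by (subst last_conv_nth) (auto simp: min_def)
    moreover have "hd (drop j p) = p ! j" using that by (simp add: hd_drop_conv_nth)
    moreover have "successively (adj G) (take i p)" "successively (adj G) (drop j p)"
      using succ by (metis append_take_drop_id successively_append_iff)+
    ultimately have "successively (adj G) ?q"
      using that by (simp add: successively_append_iff)
    moreover have "hd ?q = y" "last ?q = y'" "?q \<noteq> []"
      using that hd lst by (auto simp: hd_append)
    moreover have "set ?q \<subseteq> D \<union> {y, y'}"
      using sub by (auto dest: in_set_takeD in_set_dropD)
    ultimately have "walk ?q" unfolding walk_def by blast
    from least[OF this] that show False by simp
  qed
  have p0: "p ! 0 = y" using hd p_ne by (simp add: hd_conv_nth)
  have pl: "p ! (length p - 1) = y'" using lst p_ne by (simp add: last_conv_nth)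
  have step: "adj G (p ! i) (p ! Suc i)" if "Suc i < length p" for i
    using succ that by (simp add: successively_conv_nth)
  have dist: "distinct p"
  proof -
    \<comment> \<open>A repetition of the start is removed by dropping a prefix; any other
      repetition makes the predecessor of position \<open>i\<close> adjacent to
      \<open>p ! j\<close>, so \<open>cut\<close> applies.\<close>
    have False if "i < j" "j < length p" "p ! i = p ! j" for i j
    proof (cases i)
      case 0
      then have pj: "p ! j = y" using that p0 by simp
      let ?q = "drop j p"
      have "walk ?q"
        unfolding walk_def
        using that pj lst sub succ
        by (auto simp: hd_drop_conv_nth dest: in_set_dropD)
          (metis append_take_drop_id successively_append_iff)
      from least[OF this] that show False by simp
    next
      case (Suc k)
      then have "adj G (p ! k) (p ! j)" using step[of k] that by simp
      then show False using cut[of i j] that Suc by simp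
    qed
    then show ?thesis unfolding distinct_conv_nth by (metis linorder_neqE_nat)
  qed
  have len: "length p \<ge> 3"
  proof (rule ccontr)
    assume "\<not> length p \<ge> 3"
    then consider "length p = 1" | "length p = 2" using p_ne
      by (metis One_nat_def Suc_1 Suc_leI length_greater_0_conv le_less_Suc_eq not_less numeral_3_eq_3 less_Suc_eq)
    then show False
    proof cases
      case 1 then show ?thesis using p0 pl ne by simp
    next
      case 2 then show ?thesis using p0 pl nadj step[of 0] by simp
    qed
  qed
  have inner: "p ! i \<in> D" if "0 < i" "Suc i < length p" for i
  proof -
    have "p ! i \<noteq> y" using that p0 dist
      by (metis Suc_lessD length_greater_0_conv less_numeral_extra(3) nth_eq_iff_index_eq p_ne)
    moreover have "p ! i \<noteq> y'" using that pl dist p_ne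
      by (metis Suc_lessD diff_Suc_1 diff_less length_greater_0_conv less_irrefl nth_eq_iff_index_eq zero_less_one Suc_eq_plus1 less_diff_conv)
    ultimately show ?thesis using sub that by (meson Suc_lessD Un_iff insertE nth_mem singletonD subsetD)
  qed
  have xin: "x \<notin> set p" using sub D adj_simple(1)[OF G(1) y] adj_simple(1)[OF G(1) y'] by auto
  have "is_cycle G (x # p)"
    unfolding is_cycle_def
    using len dist xin adj_simple[OF G(1) y] adj_simple[OF G(1) y'] sub D(1) succ hd lst p_ne y adj_sym[OF y']
    by (auto simp: successively_Cons)
  then have "has_chord G (x # p)" using G(2) len unfolding chordal_def by auto
  then obtain i j where ij: "i < j" "j < Suc (length p)" "j \<noteq> Suc i"
    "\<not> (i = 0 \<and> j = length p)" "adj G ((x # p) ! i) ((x # p) ! j)"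
    unfolding has_chord_def by auto
  \<comment> \<open>A chord at \<open>x\<close> would end in an inner vertex of \<open>p\<close>,
    which lies in \<open>D\<close> and is no neighbour of \<open>x\<close>; any other chord is a
    shortcut.\<close>
  show False
  proof (cases i)
    case 0
    then have "p ! (j - 1) \<in> D" "adj G x (p ! (j - 1))"
      using ij inner[of "j - 1"] by (auto simp: nth_Cons')
    then show False using D by blast
  next
    case (Suc k)
    then have "i < j - 1" "j - 1 < length p" "adj G (p ! (i - 1)) (p ! (j - 1))"
      using ij by (auto simp: nth_Cons')
    then show False using cut[of i "j - 1"] Suc by simp
  qed
qed

text \<open>Relative to a vertex set \<open>W\<close> of a fixed graph, so that eliminating a vertex
  changes only \<open>W\<close>.\<close>

definition simplicial :: "'a ugraph \<Rightarrow> 'a set \<Rightarrow> 'a \<Rightarrow> bool" where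
  "simplicial G W y \<longleftrightarrow> y \<in> W \<and>
     (\<forall>a\<in>W. \<forall>b\<in>W. adj G y a \<longrightarrow> adj G y b \<longrightarrow> a \<noteq> b \<longrightarrow> adj G a b)"

lemma rtranclp_restrict_walk:
  assumes "(\<lambda>a b. a \<in> F \<and> b \<in> F \<and> adj G a b)\<^sup>*\<^sup>* c d" "c \<in> F"
  obtains xs where "xs \<noteq> []" "hd xs = c" "last xs = d" "set xs \<subseteq> F" "successively (adj G) xs"
    "\<And>e. e \<in> set xs \<Longrightarrow> (\<lambda>a b. a \<in> F \<and> b \<in> F \<and> adj G a b)\<^sup>*\<^sup>* c e"
proof -
  from assms(1) have "\<exists>xs. xs \<noteq> [] \<and> hd xs = c \<and> last xs = d \<and> set xs \<subseteq> F \<and> successively (adj G) xs \<and>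
     (\<forall>e\<in>set xs. (\<lambda>a b. a \<in> F \<and> b \<in> F \<and> adj G a b)\<^sup>*\<^sup>* c e)"
  proof (induction rule: rtranclp_induct)
    case base
    then show ?case using assms(2) by (intro exI[of _ "[c]"]) auto
  next
    case (step d e)
    then obtain xs where "xs \<noteq> []" "hd xs = c" "last xs = d" "set xs \<subseteq> F" "successively (adj G) xs"
     "\<forall>e\<in>set xs. (\<lambda>a b. a \<in> F \<and> b \<in> F \<and> adj G a b)\<^sup>*\<^sup>* c e" by blast
    moreover have "(\<lambda>a b. a \<in> F \<and> b \<in> F \<and> adj G a b)\<^sup>*\<^sup>* c e"
      using step.hyps by (rule rtranclp.rtrancl_into_rtrancl)
    ultimately show ?case using step.hyps
      by (intro exI[of _ "xs @ [e]"]) (auto simp: successively_append_iff)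
  qed
  then show ?thesis using that by blast
qed

text \<open>Dirac's theorem, in the form that goes through by induction: a simplicial vertex exists
  outside the closed neighbourhood of any non-universal vertex \<open>x\<close>. A component \<open>C\<close> of the
  non-neighbours of \<open>x\<close> has a clique \<open>S\<close> as its neighbourhood; the induction hypothesis for
  \<open>C \<union> S\<close> is applied at a vertex that forces the result into \<open>C\<close>.\<close>

lemma chordal_simplicial_nonneighbour:
  assumes G: "simple_graph G" "chordal G"
    and "W \<subseteq> verts G" "x \<in> W" "z \<in> W" "z \<noteq> x" "\<not> adj G x z"
  shows "\<exists>y. simplicial G W y \<and> y \<noteq> x \<and> \<not> adj G x y"
proof -
  have "finite W" using assms finite_subset unfolding simple_graph_def by blast
  then show ?thesis using assms(3-)
  proof (induction W arbitrary: x z rule: finite_psubset_induct)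
    case (psubset W)
    define F where "F = {w \<in> W. w \<noteq> x \<and> \<not> adj G x w}"
    define E where "E = (\<lambda>a b. a \<in> F \<and> b \<in> F \<and> adj G a b)"
    define C where "C = {c. E\<^sup>*\<^sup>* z c}"
    define S where "S = {s \<in> W - C. \<exists>c\<in>C. adj G c s}"
    have zF: "z \<in> F" using psubset.prems by (simp add: F_def)
    have zC: "z \<in> C" by (simp add: C_def)
    have CF: "C \<subseteq> F"
    proof
      fix c assume "c \<in> C"
      then have "E\<^sup>*\<^sup>* z c" by (simp add: C_def)
      then show "c \<in> F" by induction (use zF in \<open>auto simp: E_def\<close>)
    qed
    have S_x: "adj G x s" if "s \<in> S" for s
    proof (rule ccontr)
      assume n: "\<not> adj G x s"
      from that obtain c where c: "c \<in> C" "adj G c s" "s \<in> W" "s \<notin> C" by (auto simp: S_def)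
      then have "s \<noteq> x" using CF adj_sym by (fastforce simp: F_def)
      then have "s \<in> F" using n c by (simp add: F_def)
      then have "E c s" using c CF by (auto simp: E_def)
      then have "s \<in> C" using c(1) unfolding C_def by (auto intro: rtranclp.rtrancl_into_rtrancl)
      then show False using c by simp
    qed
    have Esym: "symp E" by (auto simp: symp_def E_def dest: adj_sym)
    have S_clique: "adj G y y'" if "y \<in> S" "y' \<in> S" "y \<noteq> y'" for y y'
    proof (rule ccontr)
      assume n: "\<not> adj G y y'"
      from that obtain c c' where c: "c \<in> C" "adj G c y" "c' \<in> C" "adj G c' y'"
        by (auto simp: S_def)
      have "E\<^sup>*\<^sup>* c z" using c(1) Esym unfolding C_def
        by (metis mem_Collect_eq symp_rtranclp sympD)
      then have "E\<^sup>*\<^sup>* c c'" using c(3) unfolding C_def by auto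
      then obtain xs where xs: "xs \<noteq> []" "hd xs = c" "last xs = c'" "set xs \<subseteq> F"
          "successively (adj G) xs"
        using rtranclp_restrict_walk[of F G c c'] c(1) CF unfolding E_def by blast
      show False
        by (rule chordal_no_detour[OF G S_x[OF that(1)] S_x[OF that(2)] that(3) n, of F xs])
          (use xs c psubset.prems adj_sym in \<open>auto simp: F_def\<close>)
    qed
    let ?H = "C \<union> S"
    have xH: "x \<notin> ?H" using CF S_x adj_simple(1)[OF G(1)] by (auto simp: F_def)
    have HW: "?H \<subset> W" using CF xH psubset.prems by (auto simp: F_def S_def)
    \<comment> \<open>All neighbours in \<open>W\<close> of a vertex of \<open>C\<close> lie in
      \<open>C \<union> S\<close>, so being simplicial there is the same as in
      \<open>W\<close>.\<close>
    have lift: "simplicial G W y \<and> y \<noteq> x \<and> \<not> adj G x y" if "simplicial G ?H y" "y \<in> C" for y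
    proof -
      have "a \<in> ?H" if "a \<in> W" "adj G y a" for a
        using that \<open>y \<in> C\<close> by (auto simp: S_def)
      then show ?thesis using that CF unfolding simplicial_def F_def by blast
    qed
    note IH = psubset.IH[OF HW]
    have HV: "?H \<subseteq> verts G" using HW psubset.prems by blast
    \<comment> \<open>In case \<open>a\<close> the vertex found is no neighbour of \<open>s\<close>,
      hence outside the clique \<open>S\<close>. In case \<open>b\<close> every vertex of
      \<open>S\<close> is adjacent to \<open>c\<close>, which excludes \<open>S\<close> again. In
      case \<open>c\<close> the set is complete and \<open>z\<close> itself serves.\<close>
    consider (a) s t where "s \<in> S" "t \<in> ?H" "t \<noteq> s" "\<not> adj G s t"
      | (b) c t where "\<forall>s\<in>S. \<forall>t\<in>?H. t \<noteq> s \<longrightarrow> adj G s t" "c \<in> C" "t \<in> ?H" "t \<noteq> c" "\<not> adj G c t"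
      | (c) "\<forall>c\<in>?H. \<forall>t\<in>?H. t \<noteq> c \<longrightarrow> adj G c t"
      by blast
    then show ?case
    proof cases
      case a
      then obtain y where y: "simplicial G ?H y" "y \<noteq> s" "\<not> adj G s y"
        using IH[OF HV, of s t] by blast
      then have "y \<in> C" using S_clique a by (auto simp: simplicial_def)
      then show ?thesis using lift y by blast
    next
      case b
      obtain y where y: "simplicial G ?H y" "y \<noteq> c" "\<not> adj G c y"
        using IH[OF HV, of c t] b by blast
      have "y \<notin> S" using y b adj_sym[of G y c] by auto
      then have "y \<in> C" using y by (auto simp: simplicial_def)
      then show ?thesis using lift y by blast
    next
      case c
      then have "simplicial G ?H z" using zC unfolding simplicial_def by (metis UnI1)
      then show ?thesis using lift zC by blast
    qed
  qed
qed

corollary chordal_simplicial: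
  assumes "simple_graph G" "chordal G" "W \<subseteq> verts G" "W \<noteq> {}"
  shows "\<exists>y. simplicial G W y"
proof (cases "\<exists>x\<in>W. \<exists>z\<in>W. z \<noteq> x \<and> \<not> adj G x z")
  case True
  then show ?thesis using chordal_simplicial_nonneighbour[OF assms(1-3)] by blast
next
  case False
  then show ?thesis using assms(4) unfolding simplicial_def by (metis ex_in_conv)
qed

subsection \<open>Inserting a simplicial vertex into a clique tree\<close>

text \<open>The last assumption makes the father of \<open>a\<close> the first, hence the highest, bag that it can be
  attached to. This is what yields the separator property.\<close>

locale clique_bags =
  fixes G :: "'a ugraph" and W :: "'a set" and m :: nat and bag :: "nat \<Rightarrow> 'a set" and par :: "nat \<Rightarrow> nat"
  assumes m_pos: "0 < m"
    and bag_sub: "a < m \<Longrightarrow> bag a \<subseteq> W"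
    and bag_clique: "a < m \<Longrightarrow> clique G (bag a)"
    and antichain: "a < m \<Longrightarrow> b < m \<Longrightarrow> bag a \<subseteq> bag b \<Longrightarrow> a = b"
    and cover: "K \<subseteq> W \<Longrightarrow> clique G K \<Longrightarrow> \<exists>a<m. K \<subseteq> bag a"
    and par_less: "0 < a \<Longrightarrow> a < m \<Longrightarrow> par a < a"
    and running: "b < a \<Longrightarrow> a < m \<Longrightarrow> bag a \<inter> bag b \<subseteq> bag (par a)"
    and par_least: "0 < a \<Longrightarrow> a < m \<Longrightarrow> b < par a \<Longrightarrow> \<not> bag a \<inter> bag (par a) \<subseteq> bag b"

text \<open>One empty bag instead of none: the empty clique has to be covered, and a root has to
  exist.\<close>

lemma clique_bags_empty: "clique_bags G {} 1 (\<lambda>_. {}) par"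
  by unfold_locales (auto simp: clique_def)

context clique_bags
begin

context
  fixes v N p
  assumes v: "v \<notin> W" "v \<in> verts G" and N_def: "N = {w \<in> W. adj G v w}"
    and N_clique: "clique G N"
    and p: "p < m" "N \<subseteq> bag p" "\<And>b. b < p \<Longrightarrow> \<not> N \<subseteq> bag b"
begin

lemma insert_clique: "clique G (insert v N)"
proof -
  have "adj G v w" "adj G w v" if "w \<in> N" for w
    using that by (auto simp: N_def intro: adj_sym)
  then show ?thesis using N_clique v(2) unfolding clique_def by auto
qed

lemma cover_insert:
  assumes "K \<subseteq> insert v W" "clique G K"
  shows "K \<subseteq> insert v N \<or> (\<exists>a<m. K \<subseteq> bag a)"
proof (cases "v \<in> K")
  case True
  then have "K - {v} \<subseteq> N" using assms unfolding N_def clique_def by auto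
  then show ?thesis by blast
next
  case False
  then show ?thesis using cover[of K] assms by auto
qed

lemma v_notin_bag: "a < m \<Longrightarrow> v \<notin> bag a"
  using bag_sub v by blast

text \<open>Here \<open>bag p = N\<close>. As \<open>v\<close> enters one bag only, intersections of
  distinct bags stay as they were, and the tree is kept unchanged.\<close>

lemma extend_bag:
  assumes "bag p \<subseteq> N"
  shows "clique_bags G (insert v W) m (bag(p := insert v (bag p))) par"
proof -
  let ?bag = "bag(p := insert v (bag p))"
  have eq: "bag p = N" using assms p by blast
  have bags: "?bag a \<inter> ?bag b = bag a \<inter> bag b" if "a < m" "b < m" "a \<noteq> b" for a b
    using that v_notin_bag by auto
  have sup: "bag a \<subseteq> ?bag a" for a by auto
  show ?thesis
  proof
    show "0 < m" by (rule m_pos)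
  next
    fix a assume "a < m"
    then show "?bag a \<subseteq> insert v W" using bag_sub[of a] bag_sub[OF p(1)] by auto
    show "clique G (?bag a)" using insert_clique bag_clique \<open>a < m\<close> eq by auto
  next
    fix a b assume ab: "a < m" "b < m" "?bag a \<subseteq> ?bag b"
    have "bag a \<subseteq> bag b"
      using ab v_notin_bag by (auto split: if_splits)
    then show "a = b" using antichain ab by blast
  next
    fix K assume "K \<subseteq> insert v W" "clique G K"
    from cover_insert[OF this] show "\<exists>a<m. K \<subseteq> ?bag a"
      using eq p(1) sup by (metis fun_upd_same order_trans)
  next
    fix a assume "0 < a" "a < m"
    then show "par a < a" by (rule par_less)
  next
    fix b a assume ba: "b < a" "a < m"
    then have "?bag a \<inter> ?bag b = bag a \<inter> bag b" by (intro bags) auto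
    also have "\<dots> \<subseteq> bag (par a)" using ba by (rule running)
    finally show "?bag a \<inter> ?bag b \<subseteq> ?bag (par a)" using sup by (rule order_trans)
  next
    fix a b assume a: "0 < a" "a < m" "b < par a"
    then have "?bag a \<inter> ?bag (par a) = bag a \<inter> bag (par a)"
      using par_less[of a] by (intro bags) auto
    \<comment> \<open>For \<open>b = p\<close> the right-hand side gains \<open>v\<close>, which
      does not lie in the intersection and so cannot help to cover it.\<close>
    moreover have "v \<notin> bag a" using a v_notin_bag by blast
    ultimately show "\<not> ?bag a \<inter> ?bag (par a) \<subseteq> ?bag b"
      using par_least[OF a] by (auto split: if_splits)
  qed
qed

text \<open>An old bag inside \<open>insert v N\<close> would lie in \<open>N\<close>, hence in
  \<open>bag p\<close>, hence be \<open>bag p\<close> itself, against the assumption; this keeps the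
  antichain. The new bag shares at least \<open>N\<close> with its father, and no bag before
  \<open>p\<close> contains \<open>N\<close>, which gives \<open>par_least\<close>.\<close>

lemma new_bag:
  assumes "\<not> bag p \<subseteq> N"
  shows "clique_bags G (insert v W) (Suc m) (bag(m := insert v N)) (par(m := p))"
proof -
  let ?bag = "bag(m := insert v N)" and ?par = "par(m := p)"
  have old: "?bag a = bag a" "?par a = par a" if "a < m" for a using that by auto
  show ?thesis
  proof
    show "0 < Suc m" by simp
  next
    fix a assume "a < Suc m"
    then show "?bag a \<subseteq> insert v W" using bag_sub by (fastforce simp: N_def less_Suc_eq)
    show "clique G (?bag a)" using insert_clique bag_clique \<open>a < Suc m\<close> by (auto simp: less_Suc_eq)
  next
    fix a b assume ab: "a < Suc m" "b < Suc m" "?bag a \<subseteq> ?bag b"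
    consider "a < m" "b < m" | "a < m" "b = m" | "a = m" "b < m" | "a = m" "b = m"
      using ab by linarith
    then show "a = b"
    proof cases
      case 1 then show ?thesis using antichain ab by simp
    next
      case 2
      then have "bag a \<subseteq> N" using ab v_notin_bag[of a] by auto
      then have "a = p" using antichain[of a p] p 2 by auto
      then show ?thesis using \<open>bag a \<subseteq> N\<close> assms by simp
    next
      case 3 then show ?thesis using ab v_notin_bag[of b] by auto
    qed auto
  next
    fix K assume "K \<subseteq> insert v W" "clique G K"
    from cover_insert[OF this] show "\<exists>a<Suc m. K \<subseteq> ?bag a"
      using old by (metis fun_upd_same less_Suc_eq)
  next
    fix a assume "0 < a" "a < Suc m"
    then show "?par a < a" using par_less p by (auto simp: less_Suc_eq)
  next
    fix b a assume ba: "b < a" "a < Suc m"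
    show "?bag a \<inter> ?bag b \<subseteq> ?bag (?par a)"
    proof (cases "a = m")
      case True
      then have "bag b \<subseteq> W" "v \<notin> bag b" using ba bag_sub v_notin_bag by auto
      moreover have "insert v N \<inter> bag b \<subseteq> bag p" using p(2) \<open>v \<notin> bag b\<close> by blast
      ultimately show ?thesis using True ba p(1) by auto
    next
      case False
      then show ?thesis using running[of b a] par_less[of a] ba by auto
    qed
  next
    fix a b assume a: "0 < a" "a < Suc m" "b < ?par a"
    show "\<not> ?bag a \<inter> ?bag (?par a) \<subseteq> ?bag b"
    proof (cases "a = m")
      case True
      then have "N \<subseteq> ?bag a \<inter> ?bag (?par a)" using p by auto
      moreover have "\<not> N \<subseteq> ?bag b" using p(3)[of b] a True p(1) by auto
      ultimately show ?thesis by blast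
    next
      case False
      then show ?thesis using par_least[of a b] par_less[of a] a by auto
    qed
  qed
qed

end
end

subsection \<open>Trees given by a parent function\<close>

text \<open>Connectivity as a closure: transitivity is immediate, whereas joining two distinct paths
  needs surgery on lists. \<open>reach_path\<close> leads back to paths.\<close>

definition reach :: "'a ugraph \<Rightarrow> 'a \<Rightarrow> 'a \<Rightarrow> bool" where
  "reach G = (\<lambda>u v. u \<in> verts G \<and> v \<in> verts G \<and> adj G u v)\<^sup>*\<^sup>*"

lemma reach_refl: "reach G u u"
  by (simp add: reach_def)

lemma reach_adj: "adj G u v \<Longrightarrow> u \<in> verts G \<Longrightarrow> v \<in> verts G \<Longrightarrow> reach G u v"
  by (auto simp: reach_def)

lemma reach_trans: "reach G u v \<Longrightarrow> reach G v w \<Longrightarrow> reach G u w"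
  by (auto simp: reach_def)

lemma reach_sym: "reach G u v \<Longrightarrow> reach G v u"
proof -
  have "symp (\<lambda>u v. u \<in> verts G \<and> v \<in> verts G \<and> adj G u v)"
    by (auto simp: symp_def dest: adj_sym)
  then show "reach G u v \<Longrightarrow> reach G v u" unfolding reach_def by (metis symp_rtranclp sympD)
qed

lemma reach_path:
  assumes "reach G u v" "u \<in> verts G"
  shows "\<exists>xs. path_betw G u xs v"
  using assms(1) unfolding reach_def
proof (induction rule: rtranclp_induct)
  case base
  then show ?case using assms(2) by (intro exI[of _ "[u]"]) (simp add: path_betw_def)
next
  case (step v w)
  then obtain xs where xs: "path_betw G u xs v" by blast
  show ?case
  proof (cases "w \<in> set xs")
    case True
    \<comment> \<open>A revisited vertex is reached by a prefix of the path, which keeps the path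
      distinct.\<close>
    then obtain ys zs where "xs = ys @ w # zs" by (meson split_list)
    then have "path_betw G u (ys @ [w]) w"
      using xs unfolding path_betw_def
      by (auto simp: successively_append_iff hd_append split: if_splits)
    then show ?thesis by blast
  next
    case False
    then have "path_betw G u (xs @ [w]) w"
      using xs step.hyps unfolding path_betw_def by (auto simp: successively_append_iff)
    then show ?thesis by blast
  qed
qed

text \<open>Serves to exclude cycles: at the cycle node of largest index, both neighbours would have
  to be its father.\<close>

lemma cycle_two_neighbours:
  assumes "is_cycle G xs" "x \<in> set xs"
  obtains y z where "y \<in> set xs" "z \<in> set xs" "y \<noteq> z" "y \<noteq> x" "z \<noteq> x" "adj G x y" "adj G x z"
proof -
  obtain ys zs where eq: "xs = ys @ x # zs" using assms(2) by (meson split_list)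
  have len: "length ys + length zs \<ge> 2" and dist: "distinct (ys @ x # zs)"
    and succ: "successively (adj G) (ys @ x # zs)"
    and last: "adj G (last (ys @ x # zs)) (hd (ys @ x # zs))"
    using assms(1) unfolding is_cycle_def eq by auto
  have nbrs: "ys \<noteq> [] \<Longrightarrow> adj G x (List.last ys)" "zs \<noteq> [] \<Longrightarrow> adj G x (hd zs)"
    using succ by (auto simp: successively_append_iff successively_Cons intro: adj_sym)
  consider "ys = []" | "zs = []" "ys \<noteq> []" | "ys \<noteq> []" "zs \<noteq> []" by blast
  then show ?thesis
  proof cases
    case 1
    then obtain a b cs where zs: "zs = a # b # cs" using len by (cases zs; cases "tl zs") auto
    show ?thesis
      by (rule that[of a "List.last (b # cs)"])
        (use 1 zs dist succ last eq in \<open>auto intro: adj_sym dest: last_in_set split: if_splits\<close>)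
  next
    case 2
    then obtain a b cs where ys: "ys = a # b # cs" using len by (cases ys; cases "tl ys") auto
    show ?thesis
      by (rule that[of a "List.last (b # cs)"])
        (use 2 ys dist nbrs last eq in \<open>auto intro: adj_sym dest: last_in_set split: if_splits\<close>)
  next
    case 3
    then have "List.last ys \<in> set ys" "hd zs \<in> set zs" by auto
    moreover from this have "List.last ys \<noteq> hd zs" using dist by auto
    ultimately show ?thesis
      by (intro that[of "List.last ys" "hd zs"]) (use 3 dist nbrs eq in auto)
  qed
qed

text \<open>The index set and the root are parameters because the construction is used twice: for
  the whole tree, and for the bags that contain a given vertex, rooted at the least such
  index.\<close>

locale parent_tree =
  fixes A :: "nat set" and r :: nat and par :: "nat \<Rightarrow> nat" and f :: "nat \<Rightarrow> 'b"
  assumes fin: "finite A" and root: "r \<in> A"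
    and par_in: "a \<in> A \<Longrightarrow> a \<noteq> r \<Longrightarrow> par a \<in> A"
    and par_lt: "a \<in> A \<Longrightarrow> a \<noteq> r \<Longrightarrow> par a < a"
    and inj: "inj_on f A"
begin

definition T :: "'b ugraph" where
  "T = UGraph (f ` A) {{f a, f (par a)} | a. a \<in> A \<and> a \<noteq> r}"

lemma verts_T: "verts T = f ` A"
  by (simp add: T_def)

lemma adj_T:
  assumes "a \<in> A" "b \<in> A"
  shows "adj T (f a) (f b) \<longleftrightarrow> (a \<noteq> r \<and> b = par a) \<or> (b \<noteq> r \<and> a = par b)"
proof -
  have eq: "f x = f y \<longleftrightarrow> x = y" if "x \<in> A" "y \<in> A" for x y
    using that inj by (simp add: inj_on_eq_iff)
  show ?thesis
    using assms par_in unfolding adj_def T_def by (auto simp: doubleton_eq_iff eq)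
qed

lemma simple_T: "simple_graph T"
  unfolding simple_graph_def
proof (intro conjI ballI)
  show "finite (verts T)" using fin by (simp add: verts_T)
  fix e assume "e \<in> edges T"
  then obtain a where a: "a \<in> A" "a \<noteq> r" "e = {f a, f (par a)}" by (auto simp: T_def)
  moreover have "f a \<noteq> f (par a)"
    using a par_in par_lt inj by (metis inj_on_eq_iff less_irrefl)
  ultimately show "\<exists>u v. u \<in> verts T \<and> v \<in> verts T \<and> u \<noteq> v \<and> e = {u, v}"
    using par_in unfolding verts_T by blast
qed

lemma reach_root: "a \<in> A \<Longrightarrow> reach T (f a) (f r)"
proof (induction a rule: less_induct)
  case (less a)
  show ?case
  proof (cases "a = r")
    case False
    then have "adj T (f a) (f (par a))" using less.prems par_in by (subst adj_T) auto
    then have "reach T (f a) (f (par a))"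
      using False less.prems par_in by (intro reach_adj) (auto simp: verts_T)
    then show ?thesis using less False par_in par_lt reach_trans by metis
  qed (simp add: reach_refl)
qed

text \<open>Following fathers leads every node to the root, which gives connectedness. In a cycle,
  the node of maximal index would have two distinct neighbours of smaller index, but only its father
  qualifies.\<close>

lemma tree_T: "is_tree T"
  unfolding is_tree_def
proof (intro conjI notI)
  show "connected_graph T"
    unfolding connected_graph_def
  proof (intro conjI ballI)
    fix u v assume "u \<in> verts T" "v \<in> verts T"
    then show "\<exists>xs. path_betw T u xs v"
      using reach_root reach_sym reach_trans unfolding verts_T by (metis imageE reach_path verts_T)
  qed (use root verts_T in auto)
next
  assume "\<exists>xs. is_cycle T xs"
  then obtain xs where xs: "is_cycle T xs" by blast
  define B where "B = {a \<in> A. f a \<in> set xs}"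
  have "xs \<noteq> []" "set xs \<subseteq> f ` A" using xs unfolding is_cycle_def verts_T by auto
  then have "B \<noteq> {}" unfolding B_def by (cases xs) auto
  moreover have finB: "finite B" using fin by (simp add: B_def)
  ultimately have M: "Max B \<in> B" by simp
  have *: "b = par (Max B)" if "b \<in> B" "b \<noteq> Max B" "adj T (f (Max B)) (f b)" for b
  proof -
    have "b < Max B" using that finB Max_ge by (metis le_neq_implies_less)
    then show ?thesis using that adj_T[of "Max B" b] par_lt[of b] M by (auto simp: B_def)
  qed
  obtain y z where "y \<in> set xs" "z \<in> set xs" "y \<noteq> z" "y \<noteq> f (Max B)" "z \<noteq> f (Max B)"
    "adj T (f (Max B)) y" "adj T (f (Max B)) z"
    using cycle_two_neighbours[OF xs, of "f (Max B)"] M by (auto simp: B_def)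
  moreover obtain b where "y = f b" "b \<in> B"
    using \<open>y \<in> set xs\<close> \<open>set xs \<subseteq> f ` A\<close> unfolding B_def by blast
  moreover obtain c where "z = f c" "c \<in> B"
    using \<open>z \<in> set xs\<close> \<open>set xs \<subseteq> f ` A\<close> unfolding B_def by blast
  ultimately show False using * by metis
qed (rule simple_T)

text \<open>The ancestor relation: one step leads from a father to a child, and every node is its
  own ancestor, just as \<open>subtree_nodes\<close> contains the node it starts from.\<close>

abbreviation anc :: "nat \<Rightarrow> nat \<Rightarrow> bool" where
  "anc \<equiv> (\<lambda>p a. a \<in> A \<and> a \<noteq> r \<and> p = par a)\<^sup>*\<^sup>*"

lemma anc_le: "anc p a \<Longrightarrow> p \<le> a"
  by (induction rule: rtranclp_induct) (auto dest: par_lt)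

text \<open>A path from the root can only descend: the root has only children as neighbours, and a
  later step upwards would return to the father, which is the entry just visited.\<close>

lemma root_path_indices:
  assumes "path_betw T (f r) xs (f a)" "a \<in> A"
  obtains ks where "xs = map f ks" "set ks \<subseteq> A" "ks \<noteq> []" "ks ! 0 = r" "last ks = a"
    "\<And>i. Suc i < length ks \<Longrightarrow> ks ! Suc i \<noteq> r \<and> ks ! i = par (ks ! Suc i)"
proof -
  have xs: "xs \<noteq> []" "hd xs = f r" "last xs = f a" "distinct xs" "set xs \<subseteq> f ` A"
    "successively (adj T) xs"
    using assms unfolding path_betw_def verts_T by auto
  define ks where "ks = map (inv_into A f) xs"
  have eq: "xs = map f ks" using xs(5) unfolding ks_def
    by (auto simp: map_idI f_inv_into_f subset_iff o_def)
  have A: "set ks \<subseteq> A" using xs(5) unfolding ks_def by (auto intro: inv_into_into)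
  have inv: "inv_into A f (f x) = x" if "x \<in> A" for x using that inj by simp
  have ne: "ks \<noteq> []" using xs by (simp add: ks_def)
  have k0: "ks ! 0 = r" using xs(1,2) root inv by (simp add: ks_def hd_conv_nth)
  have dist: "distinct ks" using xs(4) eq by (simp add: distinct_map)
  have adj: "adj T (f (ks ! i)) (f (ks ! Suc i))" if "Suc i < length ks" for i
    using xs(6) that unfolding eq by (simp add: successively_conv_nth)
  have "ks ! Suc i \<noteq> r \<and> ks ! i = par (ks ! Suc i)" if "Suc i < length ks" for i
    using that
  proof (induction i)
    case 0
    then have mem: "ks ! 0 \<in> A" "ks ! 1 \<in> A" using A ne nth_mem by (auto simp: subset_iff)
    show ?case using adj[OF 0] adj_T[OF mem] k0 by auto
  next
    case (Suc i)
    then have mem: "ks ! Suc i \<in> A" "ks ! Suc (Suc i) \<in> A" using A by (auto simp: subset_iff)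
    have "ks ! Suc (Suc i) \<noteq> ks ! i" using Suc.prems dist by (simp add: nth_eq_iff_index_eq)
    then show ?case using adj[of "Suc i"] adj_T[OF mem] Suc by auto
  qed
  moreover have "last ks = a" using xs(1,3) assms(2) inv by (simp add: ks_def last_map)
  ultimately show ?thesis using that eq A ne k0 by blast
qed

text \<open>Replaces paths by the ancestor relation. Along a root path every entry is the father of
  the next one, and conversely the entries of the path to \<open>a\<close> are closed under fathers,
  so they include all ancestors of \<open>a\<close>.\<close>

lemma subtree_nodes_T:
  assumes "p \<in> A"
  shows "subtree_nodes T (f r) (f p) = f ` {a \<in> A. anc p a}"
proof (intro equalityI subsetI)
  fix L assume "L \<in> subtree_nodes T (f r) (f p)"
  then obtain a xs where a: "L = f a" "a \<in> A" and xs: "path_betw T (f r) xs (f a)" "f p \<in> set xs"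
    by (auto simp: subtree_nodes_def verts_T)
  obtain ks where ks: "xs = map f ks" "set ks \<subseteq> A" "ks \<noteq> []" "last ks = a"
    "\<And>i. Suc i < length ks \<Longrightarrow> ks ! Suc i \<noteq> r \<and> ks ! i = par (ks ! Suc i)"
    using root_path_indices[OF xs(1) a(2)] by blast
  have "p \<in> set ks" using xs(2) ks(1,2) assms inj by (auto dest: inj_onD)
  then obtain i where i: "i < length ks" "p = ks ! i" by (auto simp: in_set_conv_nth)
  have "anc (ks ! i) (ks ! j)" if "i \<le> j" "j < length ks" for j
    using that
  proof (induction rule: dec_induct)
    case (step j)
    then have "anc (ks ! i) (ks ! j)" by simp
    moreover have "ks ! Suc j \<in> A" using step ks(2) by (auto simp: subset_iff)
    ultimately show ?case using step ks(5)[of j] by (simp add: rtranclp.rtrancl_into_rtrancl)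
  qed simp
  from this[of "length ks - 1"] have "anc p a"
    using i ks(3,4) by (simp add: last_conv_nth)
  then show "L \<in> f ` {a \<in> A. anc p a}" using a by blast
next
  fix L assume "L \<in> f ` {a \<in> A. anc p a}"
  then obtain a where a: "L = f a" "a \<in> A" "anc p a" by blast
  have "reach T (f r) (f a)" using reach_root[OF a(2)] by (rule reach_sym)
  then obtain xs where xs: "path_betw T (f r) xs (f a)"
    using reach_path root verts_T by (metis imageI)
  obtain ks where ks: "xs = map f ks" "set ks \<subseteq> A" "ks \<noteq> []" "ks ! 0 = r" "last ks = a"
    "\<And>i. Suc i < length ks \<Longrightarrow> ks ! Suc i \<noteq> r \<and> ks ! i = par (ks ! Suc i)"
    using root_path_indices[OF xs a(2)] by blast
  have closed: "par b \<in> set ks" if b: "b \<in> set ks" "b \<noteq> r" for b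
  proof -
    obtain i where i: "i < length ks" "b = ks ! i" using b by (auto simp: in_set_conv_nth)
    then obtain k where "i = Suc k" using b ks(4) by (cases i) auto
    then show ?thesis using i ks(6)[of k] by (metis Suc_lessD nth_mem)
  qed
  from a(3) have "p \<in> set ks"
    by (induction rule: converse_rtranclp_induct) (use ks closed in auto)
  then show "L \<in> subtree_nodes T (f r) (f p)"
    using xs ks(1) a by (auto simp: subtree_nodes_def verts_T)
qed

text \<open>Adjacency leaves the direction of the edge open; membership in the subtree forces
  \<open>p \<le> j\<close>, which rules out that \<open>P\<close> is the child.\<close>

lemma father_T: "father T (f r) P J \<longleftrightarrow> (\<exists>a\<in>A. a \<noteq> r \<and> P = f (par a) \<and> J = f a)"
proof
  assume fa: "father T (f r) P J"
  then have "P \<in> verts T" "J \<in> verts T" using adj_simple[OF simple_T] by (auto simp: father_def)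
  then obtain p j where pj: "P = f p" "p \<in> A" "J = f j" "j \<in> A" by (auto simp: verts_T)
  have "j \<in> {a \<in> A. anc p a}"
    using fa pj inj unfolding father_def subtree_nodes_T[OF pj(2), folded pj(1)]
    using subtree_nodes_T[OF pj(2)] by (auto dest: inj_onD)
  then have "p \<le> j" by (auto dest: anc_le)
  then show "\<exists>a\<in>A. a \<noteq> r \<and> P = f (par a) \<and> J = f a"
    using fa pj adj_T[of p j] par_lt[of p] by (auto simp: father_def)
next
  assume "\<exists>a\<in>A. a \<noteq> r \<and> P = f (par a) \<and> J = f a"
  then obtain a where a: "a \<in> A" "a \<noteq> r" "P = f (par a)" "J = f a" by blast
  have "anc (par a) a" using a by blast
  then show "father T (f r) P J"
    using a par_in[of a] adj_T[of "par a" a] unfolding father_def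
    by (auto simp: subtree_nodes_T)
qed

end

subsection \<open>The clique tree of a sequence of bags\<close>

context clique_bags
begin

lemma bag_inj: "inj_on bag {..<m}"
  using antichain by (auto simp: inj_on_def)

text \<open>By \<open>cover\<close>, a clique containing a bag lies in some bag, and
  \<open>antichain\<close> makes the two bags equal.\<close>

lemma bags_maximal_cliques:
  assumes "W = verts G"
  shows "bag ` {..<m} = {K. maximal_clique G K}"
proof (intro equalityI subsetI)
  fix K assume "K \<in> bag ` {..<m}"
  then obtain a where a: "a < m" "K = bag a" by blast
  have "K' = K" if K': "clique G K'" "K \<subseteq> K'" for K'
  proof -
    have "K' \<subseteq> W" using that assms by (simp add: clique_def)
    then obtain b where b: "b < m" "K' \<subseteq> bag b" using cover[of K'] K' by auto
    then have "a = b" using antichain[of a b] a that by auto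
    then show ?thesis using a b that by blast
  qed
  then show "K \<in> {K. maximal_clique G K}" using a bag_clique by (simp add: maximal_clique_def)
next
  fix K assume "K \<in> {K. maximal_clique G K}"
  then have K: "clique G K" "\<And>K'. clique G K' \<Longrightarrow> K \<subseteq> K' \<Longrightarrow> K' = K"
    by (auto simp: maximal_clique_def)
  then obtain a where "a < m" "K \<subseteq> bag a" using cover[of K] assms unfolding clique_def by auto
  then show "K \<in> bag ` {..<m}" using K(2)[of "bag a"] bag_clique[of a] by auto
qed

sublocale tree: parent_tree "{..<m}" 0 par bag
  using m_pos par_less bag_inj by unfold_locales (auto intro: less_trans)

text \<open>The bags containing \<open>v\<close> are closed under fathers, except at the one of
  least index: \<open>running\<close>, applied to any other such bag and the least one, puts
  \<open>v\<close> into the father. They therefore form a parent tree again.\<close>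

lemma clique_tree_bags:
  assumes "W = verts G"
  shows "clique_tree G tree.T"
  unfolding clique_tree_def
proof (intro conjI ballI)
  show "is_tree tree.T" by (rule tree.tree_T)
  show "verts tree.T = {K. maximal_clique G K}"
    using bags_maximal_cliques[OF assms] by (simp add: tree.verts_T)
next
  fix v assume v: "v \<in> verts G"
  define B where "B = {a. a < m \<and> v \<in> bag a}"
  have "clique G {v}" using v by (simp add: clique_def)
  then have "B \<noteq> {}" using cover[of "{v}"] v assms unfolding B_def by blast
  moreover have fin: "finite B" by (simp add: B_def)
  ultimately have "Min B \<in> B" by simp
  have up: "par a \<in> B" "par a < a" "a \<noteq> 0" if "a \<in> B" "a \<noteq> Min B" for a
  proof -
    have "Min B < a" using that fin by (metis Min_le le_neq_implies_less)
    then have "v \<in> bag a \<inter> bag (Min B)" "a < m" using that \<open>Min B \<in> B\<close> by (auto simp: B_def)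
    then show "par a < a" "par a \<in> B" "a \<noteq> 0"
      using running[OF \<open>Min B < a\<close>] par_less[of a] \<open>Min B < a\<close> by (auto simp: B_def)
  qed
  interpret sub: parent_tree B "Min B" par bag
    using fin \<open>Min B \<in> B\<close> up bag_inj by unfold_locales (auto simp: B_def inj_on_def)
  have "induced tree.T {K. v \<in> K} = sub.T"
    unfolding induced_def sub.T_def
  proof (intro arg_cong2[where f = UGraph])
    show "verts tree.T \<inter> {K. v \<in> K} = bag ` B"
      by (auto simp: tree.verts_T B_def)
    show "{e \<in> edges tree.T. e \<subseteq> {K. v \<in> K}} = {{bag a, bag (par a)} |a. a \<in> B \<and> a \<noteq> Min B}"
    proof (intro equalityI subsetI)
      fix e assume "e \<in> {e \<in> edges tree.T. e \<subseteq> {K. v \<in> K}}"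
      then obtain a where a: "a < m" "a \<noteq> 0" "e = {bag a, bag (par a)}" "v \<in> bag a" "v \<in> bag (par a)"
        by (auto simp: tree.T_def)
      then have "a \<in> B" "par a \<in> B" "par a < a" using par_less[of a] by (auto simp: B_def)
      \<comment> \<open>Otherwise the father would be a smaller element of \<open>B\<close>.\<close>
      then have "a \<noteq> Min B" using fin by (metis Min_le not_less)
      then show "e \<in> {{bag a, bag (par a)} |a. a \<in> B \<and> a \<noteq> Min B}" using a \<open>a \<in> B\<close> by blast
    next
      fix e assume "e \<in> {{bag a, bag (par a)} |a. a \<in> B \<and> a \<noteq> Min B}"
      then obtain a where a: "a \<in> B" "a \<noteq> Min B" "e = {bag a, bag (par a)}" by blast
      then show "e \<in> {e \<in> edges tree.T. e \<subseteq> {K. v \<in> K}}"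
        using up[OF a(1,2)] by (auto simp: tree.T_def B_def)
    qed
  qed
  then show "is_tree (induced tree.T {K. v \<in> K})" using sub.tree_T by simp
qed

text \<open>Consecutive bags in the subtree of \<open>j\<close> share a vertex outside the father of \<open>j\<close>, so removing
  any part of that father leaves the subgraph connected; minimality of the separator plays no role.\<close>

lemma subtree_no_separator:
  assumes j: "0 < j" "j < m" and S: "S \<subseteq> bag (par j)"
  shows "\<not> uv_separator (subtree_graph G tree.T (bag 0) (bag j)) u v S"
proof
  let ?H = "subtree_graph G tree.T (bag 0) (bag j)"
  let ?D = "{a \<in> {..<m}. tree.anc j a}"
  define H' where "H' = induced ?H (verts ?H - S)"
  assume "uv_separator ?H u v S"
  then have uv: "u \<in> verts ?H - S" "v \<in> verts ?H - S" and sep: "\<nexists>xs. path_betw H' u xs v"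
    unfolding uv_separator_def H'_def by auto
  have H: "?H = induced G (\<Union> (bag ` ?D))"
    using tree.subtree_nodes_T[of j] j by (simp add: subtree_graph_def)
  have bagV: "bag a \<subseteq> verts G" if "a < m" for a using bag_clique[OF that] by (simp add: clique_def)
  have vH: "verts ?H = \<Union> (bag ` ?D)" unfolding H using bagV by (auto simp: induced_def)
  have vH': "verts H' = verts ?H - S" by (auto simp: H'_def induced_def)
  have in_bag: "reach H' x y" if "a \<in> ?D" "x \<in> bag a - S" "y \<in> bag a - S" for a x y
  proof (cases "x = y")
    case False
    have mem: "x \<in> verts ?H - S" "y \<in> verts ?H - S" using that unfolding vH by auto
    have "adj G x y" using that False bag_clique[of a] by (auto simp: clique_def)
    moreover have "{x, y} \<subseteq> \<Union> (bag ` ?D)" using that by auto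
    ultimately have "adj H' x y" using mem unfolding H'_def adj_def
      by (simp add: induced_def H)
    then show ?thesis using mem vH' by (intro reach_adj) auto
  qed (simp add: reach_refl)
  \<comment> \<open>The vertex to which all others get connected: it lies in the top bag and outside
    the father, so it survives the removal of \<open>S\<close>.\<close>
  obtain x0 where x0: "x0 \<in> bag j" "x0 \<notin> bag (par j)"
    using antichain[of j "par j"] par_less[OF j] j by fastforce
  have "\<forall>x\<in>bag a - S. reach H' x0 x" if "tree.anc j a" for a
    using that
  proof (induction rule: rtranclp_induct)
    case base
    have "j \<in> ?D" using j by simp
    then show ?case using in_bag x0 S by blast
  next
    case (step b a)
    then have a: "0 < a" "a < m" "b = par a" by auto
    \<comment> \<open>Since \<open>j \<le> par a\<close>, the father of \<open>j\<close> precedes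
      the father of \<open>a\<close>, and \<open>par_least\<close> yields a vertex common to
      \<open>bag a\<close> and its father that avoids \<open>bag (par j)\<close>.\<close>
    have "par j < par a"
      using par_less[OF j] tree.anc_le[OF step.hyps(1)] a by simp
    then obtain y where y: "y \<in> bag a" "y \<in> bag b" "y \<notin> bag (par j)"
      using par_least[OF a(1,2)] a(3) by blast
    have "tree.anc j a" using step.hyps by (rule rtranclp.rtrancl_into_rtrancl)
    then have "a \<in> ?D" using a by simp
    moreover have "reach H' x0 y" "y \<in> bag a - S" using y S step.IH by auto
    ultimately show ?case using in_bag[of a y] reach_trans by metis
  qed
  then have "reach H' x0 u" "reach H' x0 v" using uv unfolding vH by auto
  then have "reach H' u v" using reach_sym reach_trans by metis
  then show False using reach_path sep uv vH' by metis
qed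

end

subsection \<open>Programs with bounded loops\<close>

text \<open>The number of iterations of a loop is the value of \<open>n\<close>, which no well-formed program changes.
  Hence such a program halts in polynomial time and denotes a function on memories.\<close>

datatype lp =
    LSkip
  | LAssign string "exp list" exp
  | LSeq lp lp (infixr ";;" 60)
  | LIf exp lp lp
  | LFor string lp

abbreviation V :: "string \<Rightarrow> exp" where
  "V x \<equiv> Get x []"

fun asg :: "lp \<Rightarrow> string set" where
  "asg LSkip = {}"
| "asg (LAssign x is e) = {x}"
| "asg (c ;; d) = asg c \<union> asg d"
| "asg (LIf e c d) = asg c \<union> asg d"
| "asg (LFor x c) = insert x (asg c)"

fun wf_lp :: "lp \<Rightarrow> bool" where
  "wf_lp (c ;; d) \<longleftrightarrow> wf_lp c \<and> wf_lp d"
| "wf_lp (LIf e c d) \<longleftrightarrow> wf_lp c \<and> wf_lp d"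
| "wf_lp (LFor x c) \<longleftrightarrow> wf_lp c \<and> x \<notin> asg c \<and> x \<noteq> ''n''"
| "wf_lp (LAssign x is e) \<longleftrightarrow> x \<noteq> ''n''"
| "wf_lp LSkip \<longleftrightarrow> True"

definition incr :: "string \<Rightarrow> mem \<Rightarrow> mem" where
  "incr x s = s((x, []) := Suc (s (x, [])))"

text \<open>The counter is increased after the body, so pass \<open>k\<close> sees the value
  \<open>k\<close> and the final value is \<open>n\<close>, exactly as in the compiled loop.\<close>

fun den :: "lp \<Rightarrow> mem \<Rightarrow> mem" where
  "den LSkip s = s"
| "den (LAssign x is e) s = s((x, map (eval s) is) := eval s e)"
| "den (c ;; d) s = den d (den c s)"
| "den (LIf e c d) s = (if eval s e \<noteq> 0 then den c s else den d s)"
| "den (LFor x c) s = ((\<lambda>t. incr x (den c t)) ^^ s (''n'', [])) (s((x, []) := 0))"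

text \<open>With truncated subtraction, \<open>n - x\<close> is nonzero iff \<open>x < n\<close>, so
  it can serve as the loop condition.\<close>

fun compile :: "lp \<Rightarrow> com" where
  "compile LSkip = Skip"
| "compile (LAssign x is e) = Assign x is e"
| "compile (c ;; d) = Seq (compile c) (compile d)"
| "compile (LIf e c d) = If e (compile c) (compile d)"
| "compile (LFor x c) = Seq (Assign x [] (Num 0))
     (While (Sub (V ''n'') (V x)) (Seq (compile c) (Assign x [] (Add (V x) (Num 1)))))"

text \<open>A branch is charged with the sum of both alternatives, since polynomials have no
  maximum. In a loop, the outer 2 pays for the initialisation and the last, failing test, the inner
  2 for the test and the increment of each pass; \<open>[:0, 1:]\<close> stands for
  \<open>n\<close>.\<close>

fun cost :: "lp \<Rightarrow> nat poly" where
  "cost (c ;; d) = cost c + cost d"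
| "cost (LIf e c d) = [:1:] + cost c + cost d"
| "cost (LFor x c) = [:2:] + [:0, 1:] * (cost c + [:2:])"
| "cost _ = [:1:]"

definition same :: "string set \<Rightarrow> mem \<Rightarrow> mem \<Rightarrow> bool" where
  "same A s t \<longleftrightarrow> (\<forall>y is. y \<notin> A \<longrightarrow> t (y, is) = s (y, is))"

lemma sameD: "same A s t \<Longrightarrow> y \<notin> A \<Longrightarrow> t (y, is) = s (y, is)"
  by (simp add: same_def)

lemma same_trans: "same A s t \<Longrightarrow> same B t u \<Longrightarrow> A \<subseteq> C \<Longrightarrow> B \<subseteq> C \<Longrightarrow> same C s u"
  unfolding same_def by (metis subsetD)

lemma same_den: "same (asg c) s (den c s)"
proof (induction c arbitrary: s)
  case (LSeq c d)
  show ?case using same_trans[OF LSeq.IH(1) LSeq.IH(2)] by simp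
next
  case (LIf e c d)
  then show ?case by (auto simp: same_def)
next
  case (LFor x c)
  have "same (insert x (asg c)) s (((\<lambda>t. incr x (den c t)) ^^ k) (s((x, []) := 0)))" for k
  proof (induction k)
    case (Suc k)
    let ?t = "((\<lambda>t. incr x (den c t)) ^^ k) (s((x, []) := 0))"
    have "same {x} (den c ?t) (incr x (den c ?t))" by (simp add: same_def incr_def)
    from same_trans[OF LFor.IH this, of "insert x (asg c)"]
    have "same (insert x (asg c)) ?t (incr x (den c ?t))" by blast
    from same_trans[OF Suc this subset_refl subset_refl] show ?case
      by (simp only: funpow.simps o_apply)
  qed (auto simp: same_def)
  then show ?case by simp
qed (auto simp: same_def)

lemma wf_lp_n: "wf_lp c \<Longrightarrow> ''n'' \<notin> asg c"
  by (induction c) auto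

lemma den_n: "wf_lp c \<Longrightarrow> den c s (''n'', is) = s (''n'', is)"
  using same_den[of c s] wf_lp_n by (auto simp: same_def)

lemma compile_correct:
  assumes "wf_lp c" "s (''n'', []) = N"
  shows "\<exists>t \<le> poly (cost c) N. exec (compile c) s t (den c s)"
  using assms
proof (induction c arbitrary: s)
  case LSkip
  then show ?case using exec.Skip[of s] by auto
next
  case (LAssign x "is" e)
  have "exec (compile (LAssign x is e)) s 1 (den (LAssign x is e) s)"
    by (simp only: compile.simps den.simps exec.Assign)
  moreover have "1 \<le> poly (cost (LAssign x is e)) N" by simp
  ultimately show ?case by blast
next
  case (LSeq c d)
  obtain t1 where t1: "t1 \<le> poly (cost c) N" "exec (compile c) s t1 (den c s)"
    using LSeq.IH(1)[of s] LSeq.prems by auto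
  moreover obtain t2 where "t2 \<le> poly (cost d) N" "exec (compile d) (den c s) t2 (den d (den c s))"
    using LSeq.IH(2)[of "den c s"] LSeq.prems den_n by auto
  ultimately show ?case by (intro exI[of _ "t1 + t2"]) (auto intro: exec.Seq)
next
  case (LIf e c d)
  show ?case
  proof (cases "eval s e = 0")
    case True
    obtain t where t: "t \<le> poly (cost d) N" "exec (compile d) s t (den d s)"
      using LIf.IH(2)[of s] LIf.prems by auto
    have "exec (compile (LIf e c d)) s (1 + t) (den (LIf e c d) s)"
      using exec.IfFalse[OF True t(2)] True by simp
    moreover have "1 + t \<le> poly (cost (LIf e c d)) N" using t(1) by simp
    ultimately show ?thesis by blast
  next
    case False
    obtain t where t: "t \<le> poly (cost c) N" "exec (compile c) s t (den c s)"
      using LIf.IH(1)[of s] LIf.prems by auto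
    have "exec (compile (LIf e c d)) s (1 + t) (den (LIf e c d) s)"
      using exec.IfTrue[OF False t(2)] False by simp
    moreover have "1 + t \<le> poly (cost (LIf e c d)) N" using t(1) by simp
    ultimately show ?thesis by blast
  qed
next
  case (LFor x c)
  let ?b = "Sub (V ''n'') (V x)" and ?body = "Seq (compile c) (Assign x [] (Add (V x) (Num 1)))"
  let ?P = "poly (cost c) N" and ?f = "\<lambda>t. incr x (den c t)"
  have x: "x \<notin> asg c" "x \<noteq> ''n''" "wf_lp c" using LFor.prems by auto
  \<comment> \<open>Generalised to \<open>k\<close> remaining passes from an arbitrary memory
    \<open>u\<close>, for induction on \<open>k\<close>.\<close>
  have loop: "\<exists>t \<le> 1 + k * (?P + 2). exec (While ?b ?body) u t ((?f ^^ k) u)"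
    if "u (''n'', []) = N" "u (x, []) + k = N" for k u
    using that
  proof (induction k arbitrary: u)
    case 0
    then show ?case using exec.WhileFalse[of u ?b ?body] by auto
  next
    case (Suc k)
    obtain t1 where t1: "t1 \<le> ?P" "exec (compile c) u t1 (den c u)"
      using LFor.IH[of u] Suc.prems x by auto
    have "exec (Assign x [] (Add (V x) (Num 1))) (den c u) 1 (?f u)"
      using exec.Assign[of x "[]" "Add (V x) (Num 1)" "den c u"] by (simp add: incr_def)
    from exec.Seq[OF t1(2) this] have body: "exec ?body u (t1 + 1) (?f u)" .
    have "den c u (x, []) = u (x, [])" using sameD[OF same_den x(1)] .
    then have "(?f u) (''n'', []) = N" "(?f u) (x, []) + k = N"
      using Suc.prems x den_n by (auto simp: incr_def)
    from Suc.IH[OF this] obtain t2 where t2: "t2 \<le> 1 + k * (?P + 2)"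
      "exec (While ?b ?body) (?f u) t2 ((?f ^^ k) (?f u))" by blast
    have "exec (While ?b ?body) u (1 + (t1 + 1) + t2) ((?f ^^ k) (?f u))"
      by (rule exec.WhileTrue[OF _ body t2(2)]) (use Suc.prems in auto)
    moreover have "1 + (t1 + 1) + t2 \<le> 1 + Suc k * (?P + 2)" using t1 t2 by simp
    ultimately show ?case by (metis comp_apply funpow_Suc_right)
  qed
  let ?u = "s((x, []) := 0)"
  have "?u (''n'', []) = N" "?u (x, []) + N = N" using LFor.prems by auto
  from loop[OF this] obtain t where t: "t \<le> 1 + N * (?P + 2)"
    "exec (While ?b ?body) ?u t ((?f ^^ N) ?u)" by blast
  have "exec (Assign x [] (Num 0)) s 1 ?u" using exec.Assign[of x "[]" "Num 0" s] by simp
  from exec.Seq[OF this t(2)] have "exec (compile (LFor x c)) s (1 + t) (den (LFor x c) s)"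
    using LFor.prems by simp
  moreover have "1 + t \<le> poly (cost (LFor x c)) N" using t(1) by simp
  ultimately show ?case by blast
qed

text \<open>The counter value and the frame condition are supplied to each step, so \<open>I\<close>
  has to describe only what the loop computes.\<close>

lemma den_LFor_induct:
  assumes wf: "wf_lp (LFor x c)" and N: "s (''n'', []) = N"
    and base: "I 0 (s((x, []) := 0))"
    and step: "\<And>k t. k < N \<Longrightarrow> I k t \<Longrightarrow> t (x, []) = k \<Longrightarrow> same (asg (LFor x c)) s t \<Longrightarrow>
      I (Suc k) ((den c t)((x, []) := Suc k))"
  shows "I N (den (LFor x c) s)"
proof -
  let ?t = "\<lambda>k. ((\<lambda>t. incr x (den c t)) ^^ k) (s((x, []) := 0))"
  have "I k (?t k) \<and> ?t k (x, []) = k \<and> same (asg (LFor x c)) s (?t k)" if "k \<le> N" for k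
    using that
  proof (induction k)
    case 0
    have "same (asg (LFor x c)) s (s((x, []) := 0))" by (simp add: same_def)
    then show ?case using base by (simp only: funpow_0 fun_upd_same)
  next
    case (Suc k)
    then have "k < N" by simp
    have IH: "I k (?t k)" "?t k (x, []) = k" "same (asg (LFor x c)) s (?t k)"
      using Suc.IH[OF Suc_leD[OF Suc.prems]] by blast+
    have "den c (?t k) (x, []) = k"
      using sameD[OF same_den[of c "?t k"], of x "[]"] wf IH by simp
    then have eq: "?t (Suc k) = (den c (?t k))((x, []) := Suc k)" by (simp add: incr_def)
    have "same (asg (LFor x c)) (?t k) (?t (Suc k))"
      unfolding eq using same_den[of c "?t k"] by (auto simp: same_def)
    then have "same (asg (LFor x c)) s (?t (Suc k))" using same_trans[OF IH(3)] by blast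
    moreover have "I (Suc k) (?t (Suc k))" unfolding eq by (rule step[OF \<open>k < N\<close> IH])
    ultimately show ?case unfolding eq by (simp only: fun_upd_same simp_thms)
  qed
  from this[of N] show ?thesis using N by simp
qed

text \<open>A scan that can only overwrite a flag evaluates a bounded existential quantifier; nested
  scans evaluate nested quantifiers.\<close>

lemma den_LFor_flag:
  assumes wf: "wf_lp (LFor x c)" and N: "s (''n'', []) = N" and x: "x \<noteq> fl"
    and step: "\<And>k t. k < N \<Longrightarrow> same (asg (LFor x c)) s t \<Longrightarrow> t (x, []) = k \<Longrightarrow>
      den c t (fl, []) = (if Q k then v else t (fl, []))"
  shows "den (LFor x c) s (fl, []) = (if \<exists>k<N. Q k then v else s (fl, []))"
  by (rule den_LFor_induct[where I = "\<lambda>k t. t (fl, []) = (if \<exists>j<k. Q j then v else s (fl, []))"])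
    (use wf N x step in \<open>auto simp: less_Suc_eq\<close>)

section \<open>Conditions and search for the least index\<close>

declare den.simps(5) [simp del]

text \<open>Logic by truncated subtraction: \<open>1 - e\<close> negates, conjunction follows by De
  Morgan with a sum as disjunction, and inequality is the absolute difference.\<close>

definition ENot :: "exp \<Rightarrow> exp" where
  "ENot e = Sub (Num 1) e"

definition EAnd :: "exp \<Rightarrow> exp \<Rightarrow> exp" where
  "EAnd a b = ENot (Add (ENot a) (ENot b))"

definition ENeq :: "exp \<Rightarrow> exp \<Rightarrow> exp" where
  "ENeq a b = Add (Sub a b) (Sub b a)"

lemma eval_conditions [simp]:
  "eval s (ENot e) = 0 \<longleftrightarrow> eval s e \<noteq> 0"
  "0 < eval s (ENot e) \<longleftrightarrow> eval s e = 0"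
  "eval s (EAnd a b) = 0 \<longleftrightarrow> eval s a = 0 \<or> eval s b = 0"
  "0 < eval s (EAnd a b) \<longleftrightarrow> 0 < eval s a \<and> 0 < eval s b"
  "eval s (ENeq a b) = 0 \<longleftrightarrow> eval s a = eval s b"
  "0 < eval s (ENeq a b) \<longleftrightarrow> eval s a \<noteq> eval s b"
  by (auto simp: ENot_def EAnd_def ENeq_def)

text \<open>Loops cannot be left early, so \<open>found\<close> freezes \<open>p\<close> at the
  first hit.\<close>

definition LSearch :: "string \<Rightarrow> lp \<Rightarrow> lp" where
  "LSearch x c = LAssign ''found'' [] (Num 0) ;; LFor x (c ;;
     LIf (EAnd (V ''ok'') (ENot (V ''found'')))
       (LAssign ''p'' [] (V x) ;; LAssign ''found'' [] (Num 1)) LSkip)"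

lemma asg_LSearch [simp]: "asg (LSearch x c) = {x, ''found'', ''p''} \<union> asg c"
  by (auto simp: LSearch_def)

lemma wf_LSearch [simp]:
  "wf_lp (LSearch x c) \<longleftrightarrow> wf_lp c \<and> x \<notin> asg c \<union> {''n'', ''found'', ''p''}"
  by (auto simp: LSearch_def)

text \<open>Minimality of the result is what later attaches a bag to the first candidate. The
  hypothesis on \<open>c\<close> ranges over all memories that agree with \<open>s\<close> on the
  unassigned names, as earlier passes leave arbitrary values in the others.\<close>

lemma den_LSearch:
  assumes wf: "wf_lp (LSearch x c)" and N: "s (''n'', []) = N"
    and c: "''found'' \<notin> asg c" "''p'' \<notin> asg c"
    and step: "\<forall>k<N. \<forall>t. same (asg (LSearch x c)) s t \<and> t (x, []) = k \<longrightarrow>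
      (den c t (''ok'', []) = 0 \<longleftrightarrow> \<not> Q k)"
    and ex: "\<exists>k<N. Q k"
  shows "den (LSearch x c) s (''p'', []) < N" "Q (den (LSearch x c) s (''p'', []))"
    "\<And>j. j < den (LSearch x c) s (''p'', []) \<Longrightarrow> \<not> Q j"
proof -
  let ?c = "c ;; LIf (EAnd (V ''ok'') (ENot (V ''found'')))
       (LAssign ''p'' [] (V x) ;; LAssign ''found'' [] (Num 1)) LSkip"
  let ?s = "s((''found'', []) := 0)"
  define I where "I k t \<longleftrightarrow> (if \<exists>j<k. Q j then t (''found'', []) \<noteq> 0 \<and> t (''p'', []) = (LEAST j. Q j)
    else t (''found'', []) = 0)" for k and t :: mem
  have x: "x \<noteq> ''found''" "x \<noteq> ''p''" "x \<notin> asg c" using wf by auto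
  have "I N (den (LFor x ?c) ?s)"
  proof (rule den_LFor_induct)
    show "wf_lp (LFor x ?c)" using wf by auto
    show "?s (''n'', []) = N" using N by simp
    show "I 0 (?s((x, []) := 0))" using x by (simp add: I_def)
  next
    fix k t assume k: "k < N" "I k t" "t (x, []) = k" "same (asg (LFor x ?c)) ?s t"
    have "same (asg (LSearch x c)) s t" using k(4) by (auto simp: same_def)
    then have ok: "den c t (''ok'', []) = 0 \<longleftrightarrow> \<not> Q k" using step k by blast
    have keep: "den c t (''found'', []) = t (''found'', [])" "den c t (''p'', []) = t (''p'', [])"
      "den c t (x, []) = k"
      using sameD[OF same_den] c x k(3) by auto
    have least: "(LEAST j. Q j) = k" if "Q k" "\<not> (\<exists>j<k. Q j)"
      using that by (intro Least_equality) (auto simp: not_less[symmetric])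
    have eqs: "den ?c t (''found'', []) = (if Q k \<and> t (''found'', []) = 0 then 1 else t (''found'', []))"
      "den ?c t (''p'', []) = (if Q k \<and> t (''found'', []) = 0 then k else t (''p'', []))"
      using ok keep by auto
    have "I (Suc k) (den ?c t)"
    proof (cases "\<exists>j<k. Q j")
      case True
      then have "\<exists>j<Suc k. Q j" using less_Suc_eq by blast
      then show ?thesis using True k(2) unfolding I_def eqs by auto
    next
      case False
      then have "(\<exists>j<Suc k. Q j) \<longleftrightarrow> Q k" by (auto simp: less_Suc_eq)
      then show ?thesis using False k(2) least unfolding I_def eqs by auto
    qed
    then show "I (Suc k) ((den ?c t)((x, []) := Suc k))" using x by (simp add: I_def)
  qed
  then have p: "den (LSearch x c) s (''p'', []) = (LEAST j. Q j)"
    using ex by (simp add: I_def LSearch_def)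
  obtain k where k: "k < N" "Q k" using ex by blast
  show "den (LSearch x c) s (''p'', []) < N" using k Least_le[of Q k] p by simp
  show "Q (den (LSearch x c) s (''p'', []))" using LeastI[of Q k] k p by simp
  show "\<not> Q j" if "j < den (LSearch x c) s (''p'', [])" for j
    using that not_less_Least p by metis
qed

subsection \<open>The algorithm\<close>

lemma den_frame: "y \<notin> asg c \<Longrightarrow> den c s (y, is) = s (y, is)"
  using sameD[OF same_den] .

text \<open>The initial value of \<open>ok\<close> already rejects vertices that have been
  removed.\<close>

definition simplicial_test :: lp where
  "simplicial_test = LAssign ''ok'' [] (ENot (Get ''rem'' [V ''v''])) ;;
     LFor ''a'' (LFor ''b'' (LIf
       (EAnd (Get ''adj'' [V ''v'', V ''a'']) (EAnd (Get ''adj'' [V ''v'', V ''b''])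
         (EAnd (ENot (Get ''rem'' [V ''a''])) (EAnd (ENot (Get ''rem'' [V ''b'']))
           (EAnd (ENeq (V ''a'') (V ''b'')) (ENot (Get ''adj'' [V ''a'', V ''b''])))))))
       (LAssign ''ok'' [] (Num 0)) LSkip))"

lemma asg_simplicial_test [simp]: "asg simplicial_test = {''ok'', ''a'', ''b''}"
  by (auto simp: simplicial_test_def)

lemma wf_simplicial_test [simp]: "wf_lp simplicial_test"
  by (simp add: simplicial_test_def)

lemma den_simplicial_test:
  assumes "s (''n'', []) = N" "s (''v'', []) = v"
  shows "den simplicial_test s (''ok'', []) = 0 \<longleftrightarrow>
    \<not> (s (''rem'', [v]) = 0 \<and> \<not> (\<exists>a<N. \<exists>b<N. s (''adj'', [v, a]) \<noteq> 0 \<and> s (''adj'', [v, b]) \<noteq> 0 \<and>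
      s (''rem'', [a]) = 0 \<and> s (''rem'', [b]) = 0 \<and> a \<noteq> b \<and> s (''adj'', [a, b]) = 0))"
proof -
  let ?C = "\<lambda>a b. s (''adj'', [v, a]) \<noteq> 0 \<and> s (''adj'', [v, b]) \<noteq> 0 \<and>
      s (''rem'', [a]) = 0 \<and> s (''rem'', [b]) = 0 \<and> a \<noteq> b \<and> s (''adj'', [a, b]) = 0"
  let ?s = "s((''ok'', []) := eval s (ENot (Get ''rem'' [V ''v''])))"
  define C where "C \<longleftrightarrow> (\<exists>a<N. \<exists>b<N. ?C a b)"
  have "den simplicial_test s (''ok'', []) = (if C then 0 else ?s (''ok'', []))"
    unfolding C_def simplicial_test_def den.simps(2,3) list.map
    apply (rule den_LFor_flag)
    subgoal by simp
    subgoal using assms by simp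
    subgoal by simp
    subgoal for a t
      apply (rule den_LFor_flag)
      subgoal by simp
      subgoal using assms by (simp add: same_def)
      subgoal by simp
      subgoal for b u using assms by (simp add: same_def)
      done
    done
  then show ?thesis unfolding C_def[symmetric] using assms(2) by simp
qed

definition elim_step :: lp where
  "elim_step = LSearch ''v'' simplicial_test ;; LAssign ''ord'' [V ''k''] (V ''p'') ;;
     LAssign ''rem'' [V ''p''] (Num 1)"

lemma asg_elim_step [simp]:
  "asg elim_step = {''ok'', ''a'', ''b'', ''v'', ''found'', ''p'', ''ord'', ''rem''}"
  by (auto simp: elim_step_def)

lemma wf_elim_step [simp]: "wf_lp elim_step"
  by (simp add: elim_step_def)

text \<open>During the insertion phase, \<open>rem\<close> marks the vertices that are not yet in the tree.\<close>

definition contains_test :: lp where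
  "contains_test = LAssign ''ok'' [] (Sub (V ''m'') (V ''a'')) ;;
     LFor ''w'' (LIf (EAnd (EAnd (ENot (Get ''rem'' [V ''w''])) (Get ''adj'' [V ''v'', V ''w'']))
         (ENot (Get ''bag'' [V ''a'', V ''w''])))
       (LAssign ''ok'' [] (Num 0)) LSkip)"

lemma asg_contains_test [simp]: "asg contains_test = {''ok'', ''w''}"
  by (auto simp: contains_test_def)

lemma wf_contains_test [simp]: "wf_lp contains_test"
  by (simp add: contains_test_def)

text \<open>The search runs over all indices below \<open>n\<close>; the initial value
  \<open>m - a\<close> of \<open>ok\<close> restricts it to existing bags.\<close>

lemma den_contains_test:
  assumes "s (''n'', []) = N" "s (''v'', []) = v" "s (''a'', []) = a"
  shows "den contains_test s (''ok'', []) = 0 \<longleftrightarrow>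
    \<not> (a < s (''m'', []) \<and>
      (\<forall>w<N. s (''rem'', [w]) = 0 \<and> s (''adj'', [v, w]) \<noteq> 0 \<longrightarrow> s (''bag'', [a, w]) \<noteq> 0))"
proof -
  let ?s = "s((''ok'', []) := s (''m'', []) - a)"
  let ?C = "\<lambda>w. s (''rem'', [w]) = 0 \<and> s (''adj'', [v, w]) \<noteq> 0 \<and> s (''bag'', [a, w]) = 0"
  have "den contains_test s (''ok'', []) = (if \<exists>w<N. ?C w then 0 else ?s (''ok'', []))"
    unfolding contains_test_def den.simps(2,3) list.map eval.simps assms(3)
    by (rule den_LFor_flag) (use assms in \<open>auto simp: same_def\<close>)
  then show ?thesis by auto
qed

text \<open>Chooses between extending and creating a bag: bag \<open>p\<close> is known to contain
  the neighbourhood, so only the converse inclusion is tested.\<close>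

definition proper_test :: lp where
  "proper_test = LAssign ''new'' [] (Num 0) ;;
     LFor ''w'' (LIf (EAnd (Get ''bag'' [V ''p'', V ''w''])
         (ENot (EAnd (ENot (Get ''rem'' [V ''w''])) (Get ''adj'' [V ''v'', V ''w'']))))
       (LAssign ''new'' [] (Num 1)) LSkip)"

lemma asg_proper_test [simp]: "asg proper_test = {''new'', ''w''}"
  by (auto simp: proper_test_def)

lemma wf_proper_test [simp]: "wf_lp proper_test"
  by (simp add: proper_test_def)

lemma den_proper_test:
  assumes "s (''n'', []) = N" "s (''v'', []) = v" "s (''p'', []) = p"
  shows "den proper_test s (''new'', []) = 0 \<longleftrightarrow>
    (\<forall>w<N. s (''bag'', [p, w]) \<noteq> 0 \<longrightarrow> s (''rem'', [w]) = 0 \<and> s (''adj'', [v, w]) \<noteq> 0)"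
proof -
  let ?s = "s((''new'', []) := 0)"
  let ?C = "\<lambda>w. s (''bag'', [p, w]) \<noteq> 0 \<and> \<not> (s (''rem'', [w]) = 0 \<and> s (''adj'', [v, w]) \<noteq> 0)"
  have "den proper_test s (''new'', []) = (if \<exists>w<N. ?C w then 1 else ?s (''new'', []))"
    unfolding proper_test_def den.simps(2,3) list.map eval.simps
    by (rule den_LFor_flag) (use assms in \<open>auto simp: same_def\<close>)
  then show ?thesis by auto
qed

text \<open>Row \<open>m\<close> is still zero, so setting marks suffices; \<open>m\<close> is
  increased last because it addresses the row being written.\<close>

definition new_bag_lp :: lp where
  "new_bag_lp = LAssign ''parent'' [V ''m''] (V ''p'') ;;
     LFor ''w'' (LIf (EAnd (ENot (Get ''rem'' [V ''w''])) (Get ''adj'' [V ''v'', V ''w'']))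
       (LAssign ''bag'' [V ''m'', V ''w''] (Num 1)) LSkip) ;;
     LAssign ''bag'' [V ''m'', V ''v''] (Num 1) ;;
     LAssign ''m'' [] (Add (V ''m'') (Num 1))"

lemma asg_new_bag_lp [simp]: "asg new_bag_lp = {''parent'', ''w'', ''bag'', ''m''}"
  by (auto simp: new_bag_lp_def)

lemma wf_new_bag_lp [simp]: "wf_lp new_bag_lp"
  by (simp add: new_bag_lp_def)

lemma den_new_bag_lp:
  assumes "s (''n'', []) = N" "s (''v'', []) = v" "s (''p'', []) = p" "s (''m'', []) = m"
  shows "den new_bag_lp s (''m'', []) = Suc m"
    "den new_bag_lp s (''parent'', is) = (if is = [m] then p else s (''parent'', is))"
    "den new_bag_lp s (''bag'', is) = (if is = [m, v] \<or>
        (\<exists>w<N. is = [m, w] \<and> s (''rem'', [w]) = 0 \<and> s (''adj'', [v, w]) \<noteq> 0)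
      then 1 else s (''bag'', is))"
proof -
  let ?Q = "\<lambda>w. s (''rem'', [w]) = 0 \<and> s (''adj'', [v, w]) \<noteq> 0"
  let ?s = "s((''parent'', [m]) := p)"
  let ?l = "LFor ''w'' (LIf (EAnd (ENot (Get ''rem'' [V ''w''])) (Get ''adj'' [V ''v'', V ''w'']))
       (LAssign ''bag'' [V ''m'', V ''w''] (Num 1)) LSkip)"
  have keep: "den ?l ?s (y, is) = ?s (y, is)" if "y \<notin> {''w'', ''bag''}" for y "is"
    by (rule den_frame) (use that in auto)
  \<comment> \<open>Quantifying over all index lists makes the invariant also say that the other
    cells of \<open>bag\<close> are untouched.\<close>
  have "\<forall>is. den ?l ?s (''bag'', is) = (if \<exists>w<N. is = [m, w] \<and> ?Q w then 1 else s (''bag'', is))"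
  proof (rule den_LFor_induct[where I = "\<lambda>k t. \<forall>is. t (''bag'', is) =
        (if \<exists>w<k. is = [m, w] \<and> ?Q w then 1 else s (''bag'', is))"])
    fix k t
    assume I: "\<forall>is. t (''bag'', is) = (if \<exists>w<k. is = [m, w] \<and> ?Q w then 1 else s (''bag'', is))"
      and k: "t (''w'', []) = k" and t: "same (asg ?l) ?s t"
    have "t (''rem'', is) = s (''rem'', is)" "t (''adj'', is) = s (''adj'', is)"
      "t (''m'', []) = m" "t (''v'', []) = v" for "is"
      using sameD[OF t] assms by auto
    then have step: "den (LIf (EAnd (ENot (Get ''rem'' [V ''w''])) (Get ''adj'' [V ''v'', V ''w'']))
       (LAssign ''bag'' [V ''m'', V ''w''] (Num 1)) LSkip) t (''bag'', is) =
       (if is = [m, k] \<and> ?Q k then 1 else t (''bag'', is))" for "is"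
      using k by auto
    have ex: "(\<exists>w<Suc k. is = [m, w] \<and> ?Q w) \<longleftrightarrow> is = [m, k] \<and> ?Q k \<or> (\<exists>w<k. is = [m, w] \<and> ?Q w)" for "is"
      by (auto simp: less_Suc_eq)
    have merge: "(if A then x else if B then x else y) = (if A \<or> B then x else y)" for A B and x y :: nat
      by simp
    have upd: "(u((''w'', []) := z)) (''bag'', is) = u (''bag'', is)" for u :: mem and z "is" by simp
    show "\<forall>is. ((den (LIf (EAnd (ENot (Get ''rem'' [V ''w''])) (Get ''adj'' [V ''v'', V ''w'']))
       (LAssign ''bag'' [V ''m'', V ''w''] (Num 1)) LSkip) t)((''w'', []) := Suc k)) (''bag'', is) =
      (if \<exists>w<Suc k. is = [m, w] \<and> ?Q w then 1 else s (''bag'', is))"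
      unfolding upd step I[rule_format] ex merge by (rule allI) (rule refl)
  qed (use assms in auto)
  then show "den new_bag_lp s (''m'', []) = Suc m"
    "den new_bag_lp s (''parent'', is) = (if is = [m] then p else s (''parent'', is))"
    "den new_bag_lp s (''bag'', is) = (if is = [m, v] \<or> (\<exists>w<N. is = [m, w] \<and> ?Q w)
      then 1 else s (''bag'', is))"
    using assms keep[of "''m''"] keep[of "''parent''"] keep[of "''v''"] by (auto simp: new_bag_lp_def)
qed

text \<open>The index \<open>n - 1 - k\<close> reads the elimination order backwards.\<close>

definition insert_step :: lp where
  "insert_step = LAssign ''v'' [] (Get ''ord'' [Sub (Sub (V ''n'') (Num 1)) (V ''k'')]) ;;
     LSearch ''a'' contains_test ;; proper_test ;;
     LIf (V ''new'') new_bag_lp (LAssign ''bag'' [V ''p'', V ''v''] (Num 1)) ;;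
     LAssign ''rem'' [V ''v''] (Num 0)"

lemma asg_insert_step [simp]: "asg insert_step =
  {''v'', ''a'', ''found'', ''p'', ''ok'', ''w'', ''new'', ''parent'', ''bag'', ''m'', ''rem''}"
  by (auto simp: insert_step_def)

lemma wf_insert_step [simp]: "wf_lp insert_step"
  by (simp add: insert_step_def)

text \<open>After the first loop every vertex is marked in \<open>rem\<close>, so insertion starts
  from the empty graph. Setting \<open>m\<close> to 1 while \<open>bag\<close> is all zero creates
  the single empty bag; \<open>root\<close> is never written and keeps its initial value 0.\<close>

definition clique_tree_lp :: lp where
  "clique_tree_lp = LFor ''k'' elim_step ;; LAssign ''m'' [] (Num 1) ;; LFor ''k'' insert_step"

lemma wf_clique_tree_lp: "wf_lp clique_tree_lp"
  by (simp add: clique_tree_lp_def)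

subsection \<open>Correctness of the algorithm\<close>

lemma simplicial_clique:
  assumes "simplicial G X y" "K \<subseteq> X" "X \<subseteq> verts G" "\<And>w. w \<in> K \<Longrightarrow> adj G y w"
  shows "clique G K"
  unfolding clique_def
proof (intro conjI ballI impI)
  show "K \<subseteq> verts G" using assms by blast
  fix u w assume "u \<in> K" "w \<in> K" "u \<noteq> w"
  moreover from this have "adj G y u" "adj G y w" "u \<in> X" "w \<in> X" using assms by auto
  ultimately show "adj G u w" using assms(1) by (simp add: simplicial_def)
qed

locale enumerated_graph =
  fixes G :: "'a ugraph" and vs :: "'a list"
  assumes simple: "simple_graph G" and chordal: "chordal G"
    and dist: "distinct vs" and vs: "set vs = verts G"
begin

definition rep :: "mem \<Rightarrow> bool" where
  "rep t \<longleftrightarrow> t (''n'', []) = length vs \<and>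
     (\<forall>i<length vs. \<forall>j<length vs. t (''adj'', [i, j]) \<noteq> 0 \<longleftrightarrow> adj G (vs ! i) (vs ! j))"

lemma rep_input: "rep (graph_input G vs)"
  by (simp add: rep_def graph_input_def)

lemma rep_same: "rep s \<Longrightarrow> same A s t \<Longrightarrow> ''n'' \<notin> A \<Longrightarrow> ''adj'' \<notin> A \<Longrightarrow> rep t"
  by (simp add: rep_def same_def)

lemma repD:
  assumes "rep t"
  shows "t (''n'', []) = length vs"
    "i < length vs \<Longrightarrow> j < length vs \<Longrightarrow> 0 < t (''adj'', [i, j]) \<longleftrightarrow> adj G (vs ! i) (vs ! j)"
  using assms by (auto simp: rep_def)

lemma vs_eq: "i < length vs \<Longrightarrow> j < length vs \<Longrightarrow> vs ! i = vs ! j \<longleftrightarrow> i = j"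
  using dist by (simp add: nth_eq_iff_index_eq)

lemma vs_verts: "i < length vs \<Longrightarrow> vs ! i \<in> verts G"
  using vs by (metis nth_mem)

lemma verts_obtain:
  assumes "x \<in> verts G" obtains i where "i < length vs" "x = vs ! i"
  using assms vs by (metis in_set_conv_nth)

lemma bag_of_iff: "i < length vs \<Longrightarrow> vs ! i \<in> bag_of vs s a \<longleftrightarrow> s (''bag'', [a, i]) \<noteq> 0"
  unfolding bag_of_def using vs_eq by auto

lemma bag_of_verts: "bag_of vs s a \<subseteq> verts G"
  using vs_verts by (auto simp: bag_of_def)

lemma set_eq_vs:
  assumes "A \<subseteq> verts G" "B \<subseteq> verts G" "\<And>i. i < length vs \<Longrightarrow> vs ! i \<in> A \<longleftrightarrow> vs ! i \<in> B"
  shows "A = B"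
  using assms verts_obtain by (metis subsetD subsetI subset_antisym)

section \<open>Correctness of the elimination phase\<close>

definition vertex :: "mem \<Rightarrow> nat \<Rightarrow> 'a" where
  "vertex t i = vs ! t (''ord'', [i])"

text \<open>A simplicial vertex belongs to the set it is simplicial in, so distinctness of the
  eliminated vertices is built in.\<close>

definition elim_inv :: "nat \<Rightarrow> mem \<Rightarrow> bool" where
  "elim_inv k t \<longleftrightarrow>
     (\<forall>i<k. t (''ord'', [i]) < length vs \<and> simplicial G (verts G - vertex t ` {..<i}) (vertex t i)) \<and>
     (\<forall>j<length vs. t (''rem'', [j]) \<noteq> 0 \<longleftrightarrow> vs ! j \<in> vertex t ` {..<k})"

lemma elim_inv_step:
  assumes t: "rep t" and k: "k < length vs" "t (''k'', []) = k" and inv: "elim_inv k t"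
  shows "elim_inv (Suc k) (den elim_step t)"
proof -
  let ?W = "verts G - vertex t ` {..<k}"
  let ?N = "length vs"
  let ?S = "LSearch ''v'' simplicial_test"
  define p where "p = den ?S t (''p'', [])"
  have rem: "t (''rem'', [j]) = 0 \<longleftrightarrow> vs ! j \<in> ?W" if "j < ?N" for j
    using inv that vs_verts[of j] by (auto simp: elim_inv_def)
  have simp_iff: "simplicial G ?W (vs ! v) \<longleftrightarrow> t (''rem'', [v]) = 0 \<and>
    \<not> (\<exists>a<?N. \<exists>b<?N. t (''adj'', [v, a]) \<noteq> 0 \<and> t (''adj'', [v, b]) \<noteq> 0 \<and>
      t (''rem'', [a]) = 0 \<and> t (''rem'', [b]) = 0 \<and> a \<noteq> b \<and> t (''adj'', [a, b]) = 0)" (is "_ \<longleftrightarrow> ?R")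
    if v: "v < ?N" for v
  proof
    assume s: "simplicial G ?W (vs ! v)"
    show ?R
    proof (intro conjI notI)
      show "t (''rem'', [v]) = 0" using s rem[OF v] by (simp add: simplicial_def)
      assume "\<exists>a<?N. \<exists>b<?N. t (''adj'', [v, a]) \<noteq> 0 \<and> t (''adj'', [v, b]) \<noteq> 0 \<and>
        t (''rem'', [a]) = 0 \<and> t (''rem'', [b]) = 0 \<and> a \<noteq> b \<and> t (''adj'', [a, b]) = 0"
      then obtain a b where ab: "a < ?N" "b < ?N" "0 < t (''adj'', [v, a])" "0 < t (''adj'', [v, b])"
        "t (''rem'', [a]) = 0" "t (''rem'', [b]) = 0" "a \<noteq> b" "t (''adj'', [a, b]) = 0" by auto
      then have "vs ! a \<in> ?W" "vs ! b \<in> ?W" "adj G (vs ! v) (vs ! a)" "adj G (vs ! v) (vs ! b)"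
        "vs ! a \<noteq> vs ! b" "\<not> adj G (vs ! a) (vs ! b)"
        using rem repD(2)[OF t] v vs_eq by (metis, metis, metis, metis, metis, metis less_irrefl)
      then show False using s unfolding simplicial_def by blast
    qed
  next
    assume R: ?R
    have R': "t (''adj'', [a, b]) \<noteq> 0" if that: "a < ?N" "b < ?N" "t (''adj'', [v, a]) \<noteq> 0"
      "t (''adj'', [v, b]) \<noteq> 0" "t (''rem'', [a]) = 0" "t (''rem'', [b]) = 0" "a \<noteq> b" for a b
    proof
      assume "t (''adj'', [a, b]) = 0"
      with that have "\<exists>b<?N. t (''adj'', [v, a]) \<noteq> 0 \<and> t (''adj'', [v, b]) \<noteq> 0 \<and>
        t (''rem'', [a]) = 0 \<and> t (''rem'', [b]) = 0 \<and> a \<noteq> b \<and> t (''adj'', [a, b]) = 0"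
        by (intro exI[of _ b]) simp
      with that(1) have "\<exists>a<?N. \<exists>b<?N. t (''adj'', [v, a]) \<noteq> 0 \<and> t (''adj'', [v, b]) \<noteq> 0 \<and>
        t (''rem'', [a]) = 0 \<and> t (''rem'', [b]) = 0 \<and> a \<noteq> b \<and> t (''adj'', [a, b]) = 0"
        by (intro exI[of _ a]) (rule conjI)
      with R[THEN conjunct2] show False by (rule notE)
    qed
    show "simplicial G ?W (vs ! v)"
      unfolding simplicial_def
    proof (intro conjI ballI impI)
      show "vs ! v \<in> ?W" using R rem[OF v] by simp
      fix x y assume xy: "x \<in> ?W" "y \<in> ?W" "adj G (vs ! v) x" "adj G (vs ! v) y" "x \<noteq> y"
      obtain a where a: "a < ?N" "x = vs ! a" using xy verts_obtain by blast
      obtain b where b: "b < ?N" "y = vs ! b" using xy verts_obtain by blast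
      have "t (''adj'', [v, a]) \<noteq> 0" "t (''adj'', [v, b]) \<noteq> 0"
        "t (''rem'', [a]) = 0" "t (''rem'', [b]) = 0" "a \<noteq> b"
        using xy a b rem repD(2)[OF t] v by auto
      from R'[OF a(1) b(1) this] have "t (''adj'', [a, b]) \<noteq> 0" .
      then show "adj G x y" using a b repD(2)[OF t] by simp
    qed
  qed
  \<comment> \<open>Only \<open>k < n\<close> vertices are gone, so the remaining set is nonempty
    and has a simplicial vertex to be found.\<close>
  have "card (vertex t ` {..<k}) < card (verts G)"
    using card_image_le[of "{..<k}" "vertex t"] k dist vs by (metis card_lessThan distinct_card finite_lessThan le_less_trans)
  then have "?W \<noteq> {}" by (metis Diff_eq_empty_iff card_mono finite_imageI finite_lessThan not_less)
  then obtain y where "simplicial G ?W y" using chordal_simplicial[OF simple chordal, of ?W] by blast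
  moreover from this obtain v where "v < ?N" "y = vs ! v" using verts_obtain unfolding simplicial_def by blast
  ultimately have ex: "\<exists>v<?N. simplicial G ?W (vs ! v)" by blast
  have step: "\<forall>v<?N. \<forall>u. same (asg ?S) t u \<and> u (''v'', []) = v \<longrightarrow>
    (den simplicial_test u (''ok'', []) = 0 \<longleftrightarrow> \<not> simplicial G ?W (vs ! v))"
  proof (intro allI impI, elim conjE)
    fix v u assume v: "v < ?N" "same (asg ?S) t u" "u (''v'', []) = v"
    have "u (''n'', []) = ?N" "u (''rem'', is) = t (''rem'', is)" "u (''adj'', is) = t (''adj'', is)" for "is"
      using sameD[OF v(2)] repD(1)[OF t] by auto
    then show "den simplicial_test u (''ok'', []) = 0 \<longleftrightarrow> \<not> simplicial G ?W (vs ! v)"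
      using v simp_iff den_simplicial_test by simp
  qed
  have p: "p < ?N" "simplicial G ?W (vs ! p)"
  proof -
    have "wf_lp ?S" "''found'' \<notin> asg simplicial_test" "''p'' \<notin> asg simplicial_test" by simp_all
    note search = den_LSearch[of "''v''" simplicial_test t ?N "\<lambda>v. simplicial G ?W (vs ! v)",
        OF this(1) repD(1)[OF t] this(2,3) step ex, folded p_def]
    show "p < ?N" by (rule search(1))
    show "simplicial G ?W (vs ! p)" by (rule search(2))
  qed
  let ?t = "den elim_step t"
  have ord: "?t (''ord'', is) = (if is = [k] then p else t (''ord'', is))" for "is"
    using k by (simp add: elim_step_def p_def den_frame)
  have rem': "?t (''rem'', is) = (if is = [p] then 1 else t (''rem'', is))" for "is"
    by (simp add: elim_step_def p_def den_frame)
  have vert: "vertex ?t i = vertex t i" if "i < k" for i using that ord by (simp add: vertex_def)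
  have vert_k: "vertex ?t k = vs ! p" using ord by (simp add: vertex_def)
  have img: "vertex ?t ` {..<i} = vertex t ` {..<i}" if "i \<le> k" for i
    using that vert by (intro image_cong) auto
  show ?thesis
    unfolding elim_inv_def
  proof (intro conjI allI impI)
    fix i assume i: "i < Suc k"
    show "?t (''ord'', [i]) < ?N" using i ord p inv by (auto simp: elim_inv_def less_Suc_eq)
    show "simplicial G (verts G - vertex ?t ` {..<i}) (vertex ?t i)"
      using i img[of i] vert vert_k p inv by (cases "i = k") (auto simp: elim_inv_def)
  next
    fix j assume j: "j < ?N"
    have "vertex ?t ` {..<Suc k} = insert (vs ! p) (vertex t ` {..<k})"
      using img[of k] vert_k by (simp add: lessThan_Suc)
    then show "?t (''rem'', [j]) \<noteq> 0 \<longleftrightarrow> vs ! j \<in> vertex ?t ` {..<Suc k}"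
      using rem'[of "[j]"] rem[OF j] vs_verts[OF j] vs_eq[OF j p(1)] by auto
  qed
qed

section \<open>Correctness of the insertion phase\<close>

definition insert_inv :: "(nat \<Rightarrow> 'a) \<Rightarrow> nat \<Rightarrow> mem \<Rightarrow> bool" where
  "insert_inv h k t \<longleftrightarrow>
     (\<forall>j<length vs. t (''rem'', [j]) = 0 \<longleftrightarrow> vs ! j \<in> h ` {length vs - k..<length vs}) \<and>
     clique_bags G (h ` {length vs - k..<length vs}) (t (''m'', [])) (bag_of vs t) (\<lambda>a. t (''parent'', [a])) \<and>
     (\<forall>a\<ge>t (''m'', []). \<forall>w. t (''bag'', [a, w]) = 0) \<and>
     t (''m'', []) \<le> max 1 k"

text \<open>The present vertices were eliminated after the one now inserted, so they belong to the
  set in which it was simplicial, and its present neighbours form a clique. In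
  \<open>insert_inv\<close>, the zero rows from \<open>m\<close> on let a bag be written without
  clearing, and \<open>m \<le> max 1 k\<close> keeps all bag indices below \<open>n\<close>, within
  reach of the search; \<open>max 1\<close> counts the initial empty bag.\<close>

lemma insert_inv_step:
  assumes t: "rep t" and k: "k < length vs" "t (''k'', []) = k" and inv: "insert_inv h k t"
    and h: "h = vertex t" "\<And>i. i < length vs \<Longrightarrow> t (''ord'', [i]) < length vs"
      "\<And>i. i < length vs \<Longrightarrow> simplicial G (verts G - h ` {..<i}) (h i)"
  shows "insert_inv h (Suc k) (den insert_step t)"
proof -
  let ?N = "length vs"
  let ?i = "?N - 1 - k"
  let ?W = "h ` {?N - k..<?N}"
  let ?m = "t (''m'', [])"
  let ?bag = "bag_of vs t"
  let ?par = "\<lambda>a. t (''parent'', [a])"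
  define v where "v = t (''ord'', [?i])"
  define M where "M = {w \<in> ?W. adj G (vs ! v) w}"
  have v: "v < ?N" "vs ! v = h ?i" using h k by (auto simp: v_def vertex_def)
  have hV: "h i \<in> verts G" "h i \<notin> h ` {..<i}" if "i < ?N" for i
    using h(3)[OF that] by (auto simp: simplicial_def)
  have inj: "i = j" if "i < ?N" "j < ?N" "h i = h j" for i j
    using that hV by (metis imageI lessThan_iff linorder_neqE_nat)
  have W_sub: "?W \<subseteq> verts G - h ` {..<?i}"
  proof
    fix x assume "x \<in> ?W"
    then obtain j where j: "x = h j" "?N - k \<le> j" "j < ?N" by auto
    have "h j \<notin> h ` {..<?i}"
    proof
      assume "h j \<in> h ` {..<?i}"
      then obtain i where "i < ?i" "h j = h i" by auto
      then show False using inj[of j i] j k by auto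
    qed
    then show "x \<in> verts G - h ` {..<?i}" using hV j by auto
  qed
  have v_W: "vs ! v \<notin> ?W"
  proof
    assume "vs ! v \<in> ?W"
    then obtain j where "j < ?N" "?N - k \<le> j" "h ?i = h j" unfolding v(2) by auto
    then show False using inj[of ?i j] k by auto
  qed
  have W_Suc: "h ` {?N - Suc k..<?N} = insert (vs ! v) ?W"
  proof -
    have "{?N - Suc k..<?N} = insert ?i {?N - k..<?N}" using k by auto
    then show ?thesis using v by simp
  qed
  have "simplicial G (verts G - h ` {..<?i}) (vs ! v)" using h(3)[of ?i] v k by simp
  then have M_clique: "clique G M"
    by (rule simplicial_clique) (use W_sub in \<open>auto simp: M_def\<close>)
  have rem: "t (''rem'', [j]) = 0 \<longleftrightarrow> vs ! j \<in> ?W" if "j < ?N" for j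
    using inv that by (auto simp: insert_inv_def)
  have nbr: "t (''rem'', [w]) = 0 \<and> 0 < t (''adj'', [v, w]) \<longleftrightarrow> vs ! w \<in> M" if "w < ?N" for w
    using that rem repD(2)[OF t v(1)] by (simp add: M_def)
  interpret clique_bags G ?W ?m ?bag ?par using inv by (simp add: insert_inv_def)
  have M_V: "M \<subseteq> verts G" using W_sub by (auto simp: M_def)
  have "\<exists>a<?m. M \<subseteq> ?bag a" using cover[OF _ M_clique] by (auto simp: M_def)
  moreover have "?m \<le> ?N" using inv k by (auto simp: insert_inv_def)
  ultimately have ex: "\<exists>a<?N. a < ?m \<and> M \<subseteq> ?bag a" by (meson less_le_trans)
  let ?S = "LSearch ''a'' contains_test"
  define t1 where "t1 = t((''v'', []) := v)"
  define t2 where "t2 = den ?S t1"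
  define p where "p = t2 (''p'', [])"
  define t3 where "t3 = den proper_test t2"
  have M_bag: "M \<subseteq> ?bag a \<longleftrightarrow>
      (\<forall>w<?N. t (''rem'', [w]) = 0 \<and> t (''adj'', [v, w]) \<noteq> 0 \<longrightarrow> t (''bag'', [a, w]) \<noteq> 0)" for a
  proof
    assume "M \<subseteq> ?bag a"
    then show "\<forall>w<?N. t (''rem'', [w]) = 0 \<and> t (''adj'', [v, w]) \<noteq> 0 \<longrightarrow> t (''bag'', [a, w]) \<noteq> 0"
      using nbr bag_of_iff by auto
  next
    assume *: "\<forall>w<?N. t (''rem'', [w]) = 0 \<and> t (''adj'', [v, w]) \<noteq> 0 \<longrightarrow> t (''bag'', [a, w]) \<noteq> 0"
    show "M \<subseteq> ?bag a"
    proof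
      fix x assume "x \<in> M"
      then obtain w where "w < ?N" "x = vs ! w" using M_V verts_obtain by blast
      then show "x \<in> ?bag a" using * nbr[of w] \<open>x \<in> M\<close> bag_of_iff[of w] by simp
    qed
  qed
  have t1: "t1 (''n'', []) = ?N" using repD(1)[OF t] by (simp add: t1_def)
  have step: "\<forall>a<?N. \<forall>u. same (asg ?S) t1 u \<and> u (''a'', []) = a \<longrightarrow>
    (den contains_test u (''ok'', []) = 0 \<longleftrightarrow> \<not> (a < ?m \<and> M \<subseteq> ?bag a))"
  proof (intro allI impI, elim conjE)
    fix a u assume a: "a < ?N" "same (asg ?S) t1 u" "u (''a'', []) = a"
    have "u (''n'', []) = ?N" "u (''v'', []) = v" "u (''rem'', is) = t (''rem'', is)"
      "u (''adj'', is) = t (''adj'', is)" "u (''bag'', is) = t (''bag'', is)" "u (''m'', []) = ?m" for "is"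
      using sameD[OF a(2)] repD(1)[OF t] by (auto simp: t1_def)
    then show "den contains_test u (''ok'', []) = 0 \<longleftrightarrow> \<not> (a < ?m \<and> M \<subseteq> ?bag a)"
      using a(3) M_bag[of a] den_contains_test[of u ?N v a] by simp
  qed
  have p: "p < ?m" "M \<subseteq> ?bag p" "\<And>b. b < p \<Longrightarrow> \<not> M \<subseteq> ?bag b"
  proof -
    have "wf_lp ?S" "''found'' \<notin> asg contains_test" "''p'' \<notin> asg contains_test" by simp_all
    note search = den_LSearch[of "''a''" contains_test t1 ?N "\<lambda>a. a < ?m \<and> M \<subseteq> ?bag a",
        OF this(1) t1 this(2,3) step ex, folded t2_def, folded p_def]
    from search(2) show "p < ?m" by (rule conjunct1)
    from search(2) show "M \<subseteq> ?bag p" by (rule conjunct2)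
    show "\<not> M \<subseteq> ?bag b" if "b < p" for b
      using search(3)[OF that] less_trans[OF that \<open>p < ?m\<close>] by simp
  qed
  have t2: "t2 (y, is) = t (y, is)"
    if "y \<notin> {''v'', ''a'', ''found'', ''p'', ''ok'', ''w''}" for y "is"
    using that by (auto simp: t2_def t1_def den_frame)
  have t2_v: "t2 (''v'', []) = v" by (simp add: t2_def t1_def den_frame)
  have t3: "t3 (y, is) = t (y, is)"
    if "y \<notin> {''v'', ''a'', ''found'', ''p'', ''ok'', ''w'', ''new''}" for y "is"
    using that t2[of y "is"] by (simp add: t3_def den_frame)
  have t3_vp: "t3 (''v'', []) = v" "t3 (''p'', []) = p"
    using t2_v by (simp_all add: t3_def den_frame p_def)
  have t3_n: "t3 (''n'', []) = ?N" using t3[of "''n''"] repD(1)[OF t] by simp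
  have new: "t3 (''new'', []) = 0 \<longleftrightarrow> ?bag p \<subseteq> M"
  proof -
    have "t3 (''new'', []) = 0 \<longleftrightarrow> (\<forall>w<?N. t (''bag'', [p, w]) \<noteq> 0 \<longrightarrow> vs ! w \<in> M)"
      unfolding t3_def
      using den_proper_test[of t2 ?N v p] t2_v t2 repD(1)[OF t] nbr by (simp add: p_def)
    also have "\<dots> \<longleftrightarrow> ?bag p \<subseteq> M" using bag_of_iff by (auto simp: bag_of_def)
    finally show ?thesis .
  qed
  define t4 where "t4 = den (LIf (V ''new'') new_bag_lp (LAssign ''bag'' [V ''p'', V ''v''] (Num 1))) t3"
  define t5 where "t5 = den insert_step t"
  have t5: "t5 = t4((''rem'', [v]) := 0)"
  proof -
    have "den (LAssign ''v'' [] (Get ''ord'' [Sub (Sub (V ''n'') (Num 1)) (V ''k'')])) t = t1"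
      using repD(1)[OF t] k by (simp add: t1_def v_def)
    moreover have "t4 (''v'', []) = v" using t3_vp by (simp add: t4_def den_frame)
    ultimately show ?thesis
      by (simp add: t5_def insert_step_def t4_def t3_def t2_def)
  qed
  note step_ctx = v_W vs_verts[OF v(1)] M_def M_clique p
  have main: "clique_bags G (insert (vs ! v) ?W) (t5 (''m'', [])) (bag_of vs t5) (\<lambda>a. t5 (''parent'', [a])) \<and>
     (\<forall>a\<ge>t5 (''m'', []). \<forall>w. t5 (''bag'', [a, w]) = 0) \<and> t5 (''m'', []) \<le> max 1 (Suc k)"
  proof (cases "?bag p \<subseteq> M")
    case True
    then have t4: "t4 = t3((''bag'', [p, v]) := 1)" using new t3_vp by (simp add: t4_def)
    have m5: "t5 (''m'', []) = ?m" "t5 (''parent'', is) = t (''parent'', is)" for "is"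
      using t3 by (simp_all add: t5 t4)
    have b5: "t5 (''bag'', is) = (if is = [p, v] then 1 else t (''bag'', is))" for "is"
      using t3 by (simp add: t5 t4)
    have "bag_of vs t5 = ?bag(p := insert (vs ! v) (?bag p))"
    proof
      fix a
      show "bag_of vs t5 a = (?bag(p := insert (vs ! v) (?bag p))) a"
        by (rule set_eq_vs) (use bag_of_verts vs_verts[OF v(1)] b5 bag_of_iff vs_eq v(1) in auto)
    qed
    moreover have "t5 (''bag'', [a, w]) = 0" if "?m \<le> a" for a w
      using that p(1) b5 inv by (simp add: insert_inv_def)
    moreover have "?m \<le> max 1 (Suc k)" using inv by (simp add: insert_inv_def le_max_iff_disj) linarith
    ultimately show ?thesis
      using extend_bag[OF step_ctx True] m5 by simp
  next
    case False
    then have t4: "t4 = den new_bag_lp t3" using new by (simp add: t4_def)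
    note d = den_new_bag_lp[of t3 ?N v p ?m, OF t3_n t3_vp, folded t4]
    have t3_m: "t3 (''m'', []) = ?m" using t3 by simp
    have m5: "t5 (''m'', []) = Suc ?m" using d(1)[OF t3_m] by (simp add: t5)
    have "(\<lambda>a. t5 (''parent'', [a])) = ?par(?m := p)"
      using d(2)[OF t3_m] t3 by (auto simp: t5)
    moreover have b5: "t5 (''bag'', is) = (if is = [?m, v] \<or> (\<exists>w<?N. is = [?m, w] \<and> vs ! w \<in> M)
      then 1 else t (''bag'', is))" for "is"
    proof -
      have nbr3: "t3 (''rem'', [w]) = 0 \<and> t3 (''adj'', [v, w]) \<noteq> 0 \<longleftrightarrow> vs ! w \<in> M" if "w < ?N" for w
        using nbr[OF that] t3 by simp
      have "(\<exists>w<?N. is = [?m, w] \<and> t3 (''rem'', [w]) = 0 \<and> t3 (''adj'', [v, w]) \<noteq> 0) \<longleftrightarrow>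
         (\<exists>w<?N. is = [?m, w] \<and> vs ! w \<in> M)"
        using nbr3 by auto
      moreover have "t5 (''bag'', is) = t4 (''bag'', is)" "t3 (''bag'', is) = t (''bag'', is)"
        using t3 by (simp_all add: t5)
      ultimately show ?thesis using d(3)[OF t3_m, of "is"] by (simp only:)
    qed
    have old: "t (''bag'', [a, w]) = 0" if "?m \<le> a" for a w using that inv by (simp add: insert_inv_def)
    have "bag_of vs t5 = ?bag(?m := insert (vs ! v) M)"
    proof
      fix a
      show "bag_of vs t5 a = (?bag(?m := insert (vs ! v) M)) a"
        by (rule set_eq_vs)
          (use bag_of_verts vs_verts[OF v(1)] b5 bag_of_iff vs_eq v(1) M_V old in \<open>auto split: if_splits\<close>)
    qed
    moreover have "t5 (''bag'', [a, w]) = 0" if "Suc ?m \<le> a" for a w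
      using that b5 old by simp
    \<comment> \<open>The first vertex extends the empty bag. A new bag is thus created only when
      \<open>max 1 (Suc k)\<close> exceeds \<open>max 1 k\<close>, which preserves the bound on
      \<open>m\<close>.\<close>
    moreover have "k \<noteq> 0"
    proof
      assume "k = 0"
      then have "?bag p = {}" using bag_sub[OF p(1)] by simp
      then show False using False by simp
    qed
    then have "Suc ?m \<le> max 1 (Suc k)" using inv by (simp add: insert_inv_def)
    ultimately show ?thesis
      using new_bag[OF step_ctx False] m5 by simp
  qed
  have "t5 (''rem'', [j]) = 0 \<longleftrightarrow> vs ! j \<in> insert (vs ! v) ?W" if j: "j < ?N" for j
  proof -
    have "t4 (''rem'', [j]) = t (''rem'', [j])" using t3 by (simp add: t4_def den_frame)
    then show ?thesis using rem[OF j] vs_eq[OF j v(1)] by (simp add: t5)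
  qed
  with main show ?thesis unfolding insert_inv_def W_Suc t5_def[symmetric] by blast
qed

lemma elim_inv_upd: "elim_inv k (t((''k'', []) := i)) \<longleftrightarrow> elim_inv k t"
  by (simp add: elim_inv_def vertex_def)

lemma bag_of_cong: "(\<And>is. t (''bag'', is) = s (''bag'', is)) \<Longrightarrow> bag_of vs t = bag_of vs s"
  by (auto simp: bag_of_def)

lemma insert_inv_cong:
  assumes "\<And>y is. y \<in> {''rem'', ''m'', ''bag'', ''parent''} \<Longrightarrow> t (y, is) = s (y, is)"
  shows "insert_inv h k t \<longleftrightarrow> insert_inv h k s"
  using assms bag_of_cong[of t s] by (simp add: insert_inv_def)

lemma clique_tree_lp_correct:
  defines "s \<equiv> den clique_tree_lp (graph_input G vs)"
  shows "clique_bags G (verts G) (s (''m'', [])) (bag_of vs s) (\<lambda>a. s (''parent'', [a]))"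
    and "s (''root'', []) = 0"
proof -
  let ?N = "length vs"
  define t0 where "t0 = graph_input G vs"
  define t1 where "t1 = den (LFor ''k'' elim_step) t0"
  define t2 where "t2 = t1((''m'', []) := 1)"
  have s: "s = den (LFor ''k'' insert_step) t2"
    by (simp add: s_def clique_tree_lp_def t0_def t1_def t2_def)
  have rep0: "rep t0" by (simp add: t0_def rep_input)
  have zero: "t0 (y, is) = 0" if "y \<notin> {''n'', ''adj''}" for y "is"
    using that by (simp add: t0_def graph_input_def)
  have "elim_inv ?N t1"
    unfolding t1_def
  proof (rule den_LFor_induct[where I = elim_inv])
    show "elim_inv 0 (t0((''k'', []) := 0))" using zero by (simp add: elim_inv_def)
    fix k t
    assume k: "k < ?N" "elim_inv k t" "t (''k'', []) = k" "same (asg (LFor ''k'' elim_step)) t0 t"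
    have "rep t" by (rule rep_same[OF rep0 k(4)]) simp_all
    then show "elim_inv (Suc k) ((den elim_step t)((''k'', []) := Suc k))"
      unfolding elim_inv_upd by (rule elim_inv_step[OF _ k(1,3,2)])
  qed (use repD(1)[OF rep0] in simp_all)
  define h where "h = vertex t1"
  have h: "t1 (''ord'', [i]) < ?N" "simplicial G (verts G - h ` {..<i}) (h i)" if "i < ?N" for i
    using \<open>elim_inv ?N t1\<close> that by (auto simp: elim_inv_def h_def)
  have rem: "t1 (''rem'', [j]) \<noteq> 0 \<longleftrightarrow> vs ! j \<in> h ` {..<?N}" if "j < ?N" for j
    using \<open>elim_inv ?N t1\<close> that by (simp add: elim_inv_def h_def)
  have hV: "h i \<in> verts G" "h i \<notin> h ` {..<i}" if "i < ?N" for i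
    using h(2)[OF that] by (auto simp: simplicial_def)
  \<comment> \<open>Each vertex is still present when it is eliminated, so none occurs twice;
    \<open>n\<close> distinct vertices exhaust the graph.\<close>
  have "inj_on h {..<?N}"
    unfolding inj_on_def using hV(2) by (metis imageI lessThan_iff linorder_neqE_nat)
  then have "card (h ` {..<?N}) = card (verts G)"
    using vs dist by (metis card_image card_lessThan distinct_card)
  moreover have "h ` {..<?N} \<subseteq> verts G" using hV(1) by auto
  moreover have "finite (verts G)" using vs by (metis List.finite_set)
  ultimately have img: "h ` {..<?N} = verts G" by (simp add: card_subset_eq)
  have "rep t2"
    by (rule rep_same[OF rep0, of "asg (LFor ''k'' elim_step) \<union> {''m''}"])
      (auto simp: same_def t2_def t1_def den_frame)
  have "insert_inv h ?N s"
    unfolding s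
  proof (rule den_LFor_induct[where I = "insert_inv h"])
    have bag: "t2 (''bag'', is) = 0" for "is"
      using zero[of "''bag''"] by (simp add: t2_def t1_def den_frame)
    then have "bag_of vs t2 = (\<lambda>_. {})" by (simp add: bag_of_def fun_eq_iff)
    moreover have "t2 (''rem'', [j]) \<noteq> 0" if "j < ?N" for j
      using rem[OF that] vs_verts[OF that] img by (simp add: t2_def)
    moreover have "t2 (''m'', []) = 1" by (simp add: t2_def)
    ultimately have "insert_inv h 0 t2"
      using clique_bags_empty bag by (simp add: insert_inv_def)
    then show "insert_inv h 0 (t2((''k'', []) := 0))"
      by (subst insert_inv_cong[where s = t2]) auto
  next
    fix k t
    assume k: "k < ?N" "insert_inv h k t" "t (''k'', []) = k" "same (asg (LFor ''k'' insert_step)) t2 t"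
    have "rep t" by (rule rep_same[OF \<open>rep t2\<close> k(4)]) simp_all
    have ord: "t (''ord'', is) = t1 (''ord'', is)" for "is"
      using sameD[OF k(4), of "''ord''"] by (simp add: t2_def)
    then have "h = vertex t" by (auto simp: h_def vertex_def)
    have "insert_inv h (Suc k) (den insert_step t)"
      by (rule insert_inv_step[OF \<open>rep t\<close> k(1,3,2) \<open>h = vertex t\<close>]) (use h ord in auto)
    then show "insert_inv h (Suc k) ((den insert_step t)((''k'', []) := Suc k))"
      by (subst insert_inv_cong[where s = "den insert_step t"]) auto
  qed (use repD(1)[OF \<open>rep t2\<close>] in simp_all)
  then show "clique_bags G (verts G) (s (''m'', [])) (bag_of vs s) (\<lambda>a. s (''parent'', [a]))"
    using img by (simp add: insert_inv_def atLeast0LessThan)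
  show "s (''root'', []) = 0" using zero by (simp add: s t2_def t1_def den_frame)
qed

end

theorem theorem5p1:
  shows "\<exists>(c :: com) (p :: nat poly). \<forall>(G :: 'a ugraph) vs.
    simple_graph G \<and> chordal G \<and> distinct vs \<and> set vs = verts G \<longrightarrow>
    (\<exists>t s T R.
       exec c (graph_input G vs) t s \<and> t \<le> poly p (length vs) \<and>
       tree_output vs s T R \<and> rooted_clique_tree G T R \<and>
       (\<forall>K\<in>verts T - {R}. \<forall>P. father T R P K \<longrightarrow>
          (\<forall>J. father T R P J \<longrightarrow>
             \<not> (\<exists>S. minimal_separator (subtree_graph G T R J) S \<and> S \<subseteq> K \<inter> P))))"
proof (intro exI[of _ "compile clique_tree_lp"] exI[of _ "cost clique_tree_lp"] allI impI)
  fix G :: "'a ugraph" and vs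
  assume "simple_graph G \<and> chordal G \<and> distinct vs \<and> set vs = verts G"
  then interpret enumerated_graph G vs by unfold_locales auto
  define s where "s = den clique_tree_lp (graph_input G vs)"
  let ?m = "s (''m'', [])" and ?bag = "bag_of vs s" and ?par = "\<lambda>a. s (''parent'', [a])"
  interpret clique_bags G "verts G" ?m ?bag ?par
    using clique_tree_lp_correct(1) by (simp add: s_def)
  have root: "s (''root'', []) = 0" using clique_tree_lp_correct(2) by (simp add: s_def)
  have "graph_input G vs (''n'', []) = length vs" by (rule repD(1)[OF rep_input])
  from compile_correct[of _ "graph_input G vs", OF wf_clique_tree_lp this] obtain t where
    t: "t \<le> poly (cost clique_tree_lp) (length vs)"
      "exec (compile clique_tree_lp) (graph_input G vs) t s"
    unfolding s_def by blast
  have out: "tree_output vs s tree.T (?bag 0)"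
    using bag_inj m_pos par_less root unfolding tree_output_def
    by (auto simp: bij_betw_def tree.verts_T tree.father_T intro: less_trans)
  have rct: "rooted_clique_tree G tree.T (?bag 0)"
    using clique_tree_bags m_pos by (auto simp: rooted_clique_tree_def tree.verts_T)
  \<comment> \<open>From \<open>S \<subseteq> K \<inter> P\<close> only
    \<open>S \<subseteq> P\<close> is passed on: no subset of the father separates the graph of any
    of its children.\<close>
  have no_sep: "\<not> minimal_separator (subtree_graph G tree.T (?bag 0) J) S"
    if P: "father tree.T (?bag 0) P J" and S: "S \<subseteq> K \<inter> P" for J P K S
  proof -
    obtain j where "0 < j" "j < ?m" "P = ?bag (?par j)" "J = ?bag j"
      using P unfolding tree.father_T by auto
    then show ?thesis
      using subtree_no_separator[of j S] S unfolding minimal_separator_def by auto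
  qed
  show "\<exists>t s T R. exec (compile clique_tree_lp) (graph_input G vs) t s \<and>
       t \<le> poly (cost clique_tree_lp) (length vs) \<and>
       tree_output vs s T R \<and> rooted_clique_tree G T R \<and>
       (\<forall>K\<in>verts T - {R}. \<forall>P. father T R P K \<longrightarrow>
          (\<forall>J. father T R P J \<longrightarrow>
             \<not> (\<exists>S. minimal_separator (subtree_graph G T R J) S \<and> S \<subseteq> K \<inter> P)))"
    using t out rct no_sep
    by (intro exI[of _ t] exI[of _ s] exI[of _ tree.T] exI[of _ "?bag 0"] conjI) blast+
qed

end
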